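(* Let $F_0$ be an area-preserving map with an elliptic fixed point at the origin which is resonant of order $n$, let $N_0=R_{\alpha_0}\circ\Phi^1_{H_0}$ be a Birkhoff normal form of $F_0$, and let the corresponding Hamiltonian $H_0$ in Takens normal form be written in symplectic polar coordinates as $$H_0(I,\varphi)=I^2\sum_{k\ge 0} a_kI^k+\sum_{j\ge 1,\,k\ge 0} a_{jk}I^{jn/2+k}\cos (j n\varphi +\beta_{jk}),$$ with $a_k,a_{jk},\beta_{jk}\in\mathbb R$. Assume that $$a_{10}=0,\qquad a_0\ne 0,\qquad a_{11}^2e^{i2\beta_{11}}-8a_0a_{20}e^{i\beta_{20}}\ne 0 .$$ Then there is a formal canonical change of coordinates such that in the new variables the map $N_0$ takes the form $\widetilde N_0 =R_{\alpha_0}\circ \Phi^1_{\widetilde H_0}$ with $$\widetilde H_0(I,\varphi )=I^{2}\sum_{k\ge 0} \tilde a_k I^k +I^{n/2} \sum_{k\ge 1} b_k \cos (n\varphi + \psi_k )\, I^{2k} +I^{n} \cos (2n\varphi) \sum_{k\ge 0}c_k I^{2k},$$ where $\tilde a_k,b_k,c_k,\psi_k$ are real numbers.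
   Context: Area-preserving maps (APM) $F_0$ of $\mathbb R^2$ (near the origin) preserve area and orientation and have $F_0(0)=0$. The fixed point is elliptic: the eigenvalues of $DF_0(0)$ are non-real, $\lambda_0=e^{i\alpha_0}$ and $\lambda_0^{-1}=\bar\lambda_0$; after a linear area-preserving change of variables $DF_0(0)=R_{\alpha_0}$, the rotation of the plane by angle $\alpha_0$. The fixed point is resonant of order $n$ if $n$ is the least positive integer with $\lambda_0^n=1$ (so $n\ge 3$, since $\lambda_0$ is non-real). Complex variables: $z=(x+iy)/\sqrt2$, $\bar z=(x-iy)/\sqrt2$. Symplectic polar coordinates: $x=\sqrt{2I}\cos\varphi$, $y=\sqrt{2I}\sin\varphi$, i.e. $z=\sqrt I e^{i\varphi}$, $\bar z=\sqrt I e^{-i\varphi}$. Formal series in $(I,\varphi)$ are understood as formal power series in $(z,\bar z)$ rewritten in these coordinates. For a real-valued formal Hamiltonian $H$, $\Phi^t_H$ denotes the (formal) Hamiltonian flow generated by $H$, with equation $\dot z=-i\,\partial H/\partial\bar z$. A formal canonical change of coordinates is an invertible formal power series change of variables, fixing the origin, that preserves the area form. Birkhoff normal form (BNF): a formal area-preserving map $N_0$ with linear part $R_{\alpha_0}$, formally conjugate to $F_0$ by a canonical change of coordinates, that commutes with $R_{\alpha_0}$. It can be written $N_0=R_{\alpha_0}\circ\Phi^1_{H_0}$, where $H_0$ is a formal Hamiltonian with $H_0\circ R_{\alpha_0}=H_0$ (Takens normal form, TNF), i.e. $$H_0(z,\bar z)=\sum_{k+l\ge 3,\ k\equiv l\ (\mathrm{mod}\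 n)}h_{kl}z^k\bar z^l,\qquad h_{kl}=\overline{h_{lk}}.$$ *)

theory Defs
  imports "HOL-Analysis.Analysis"
begin

text \<open>
  A formal power series $\sum h_{kl} z^k \bar z^l$ is an element of \<open>\<complex>[[\<bar>z]][[z]]\<close>: the outer index
  is the exponent of $z$, the inner one the exponent of $\bar z$.
\<close>

type_synonym bifps = "complex fps fps"

definition bicoeff :: "bifps \<Rightarrow> nat \<Rightarrow> nat \<Rightarrow> complex" where
  "bicoeff h k l = fps_nth (fps_nth h k) l"

definition Abs_bifps :: "(nat \<Rightarrow> nat \<Rightarrow> complex) \<Rightarrow> bifps" where
  "Abs_bifps c = Abs_fps (\<lambda>k. Abs_fps (\<lambda>l. c k l))"

definition biconst :: "complex \<Rightarrow> bifps" where
  "biconst c = fps_const (fps_const c)"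

definition varz :: bifps where "varz = fps_X"

definition varzbar :: bifps where "varzbar = fps_const fps_X"

definition deriv_z :: "bifps \<Rightarrow> bifps" where
  "deriv_z h = Abs_bifps (\<lambda>k l. of_nat (k + 1) * bicoeff h (k + 1) l)"

definition deriv_zbar :: "bifps \<Rightarrow> bifps" where
  "deriv_zbar h = Abs_bifps (\<lambda>k l. of_nat (l + 1) * bicoeff h k (l + 1))"

text \<open>The series of the complex conjugate of the values of \<open>h\<close>.\<close>

definition conj_bifps :: "bifps \<Rightarrow> bifps" where
  "conj_bifps h = Abs_bifps (\<lambda>k l. cnj (bicoeff h l k))"

definition real_valued :: "bifps \<Rightarrow> bool" where
  "real_valued h \<longleftrightarrow> conj_bifps h = h"

text \<open>
  \<open>bi_subst h u v\<close> is $\sum h_{kl} u^k v^l$. It is meaningful only if \<open>u\<close> and \<open>v\<close> have zero constant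
  term; then $u^k v^l$ has no terms of total degree below $k + l$, so the sum below is complete.
\<close>

definition bi_subst :: "bifps \<Rightarrow> bifps \<Rightarrow> bifps \<Rightarrow> bifps" where
  "bi_subst h u v = Abs_bifps (\<lambda>p q.
     \<Sum>(k, l) \<in> {(k, l). k + l \<le> p + q}. bicoeff h k l * bicoeff (u ^ k * v ^ l) p q)"


text \<open>
  A formal map of the (real) plane fixing the origin is $z \mapsto f(z, \bar z)$,
  $\bar z \mapsto \overline{f(z, \bar z)}$; it is represented by the series \<open>f\<close>.
\<close>

definition formal_map :: "bifps \<Rightarrow> bool" where
  "formal_map f \<longleftrightarrow> bicoeff f 0 0 = 0"

text \<open>\<open>bi_compose h f\<close> is \<open>h \<circ> f\<close>, for \<open>h\<close> a function or another formal map.\<close>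

definition bi_compose :: "bifps \<Rightarrow> bifps \<Rightarrow> bifps" where
  "bi_compose h f = bi_subst h f (conj_bifps f)"

text \<open>
  The Jacobian determinant in $(z, \bar z)$; it coincides with the one in $(x, y)$ because the
  two coordinate systems differ by a constant linear map.
\<close>

definition formal_jacobian :: "bifps \<Rightarrow> bifps" where
  "formal_jacobian f =
     deriv_z f * deriv_zbar (conj_bifps f) - deriv_zbar f * deriv_z (conj_bifps f)"

definition formal_area_preserving :: "bifps \<Rightarrow> bool" where
  "formal_area_preserving f \<longleftrightarrow> formal_map f \<and> formal_jacobian f = 1"

definition formal_invertible :: "bifps \<Rightarrow> bool" where
  "formal_invertible f \<longleftrightarrow>
     (\<exists>g. formal_map g \<and> bi_compose f g = varz \<and> bi_compose g f = varz)"

definition formal_canonical_change :: "bifps \<Rightarrow> bool" where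
  "formal_canonical_change f \<longleftrightarrow> formal_area_preserving f \<and> formal_invertible f"

definition formal_rotation :: "real \<Rightarrow> bifps" where
  "formal_rotation \<alpha> = biconst (cis \<alpha>) * varz"

text \<open>
  \<open>formal_flow H \<Phi>\<close>: the family \<open>\<Phi> t\<close> solves $\dot z = -i\,\partial H / \partial\bar z$, coefficient by
  coefficient, with \<open>\<Phi> 0\<close> the identity. It is applied to Hamiltonians without terms of degree
  below 3, for which there is exactly one such family.
\<close>

definition formal_flow :: "bifps \<Rightarrow> (real \<Rightarrow> bifps) \<Rightarrow> bool" where
  "formal_flow H \<Phi> \<longleftrightarrow>
     \<Phi> 0 = varz \<and> (\<forall>t. formal_map (\<Phi> t)) \<and>
     (\<forall>t p q. ((\<lambda>s. bicoeff (\<Phi> s) p q) has_vector_derivative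
        bicoeff (bi_compose (biconst (- \<i>) * deriv_zbar H) (\<Phi> t)) p q) (at t))"

text \<open>\<open>N\<close> is the composition of the time-one map of \<open>H\<close> with the rotation by \<open>\<alpha>\<close>.\<close>

definition rotated_time_one_map :: "real \<Rightarrow> bifps \<Rightarrow> bifps \<Rightarrow> bool" where
  "rotated_time_one_map \<alpha> H N \<longleftrightarrow>
     (\<exists>\<Phi>. formal_flow H \<Phi> \<and> N = bi_compose (formal_rotation \<alpha>) (\<Phi> 1))"

definition takens_normal_form :: "real \<Rightarrow> bifps \<Rightarrow> bool" where
  "takens_normal_form \<alpha> H \<longleftrightarrow>
     real_valued H \<and> (\<forall>k l. k + l < 3 \<longrightarrow> bicoeff H k l = 0) \<and>
     bi_compose H (formal_rotation \<alpha>) = H"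

text \<open>
  Substituting $z = \sqrt I e^{i\varphi}$, $\bar z = \sqrt I e^{-i\varphi}$ turns \<open>H\<close> into a formal
  series in $\sqrt I$; this is the coefficient of $I^{d/2}$, a function of $\varphi$.
\<close>

definition polar_coeff :: "bifps \<Rightarrow> nat \<Rightarrow> real \<Rightarrow> complex" where
  "polar_coeff H d \<phi> = (\<Sum>k\<le>d. bicoeff H k (d - k) * (cis \<phi> ^ k * cis (- \<phi>) ^ (d - k)))"


definition partial_deriv :: "2 \<Rightarrow> (real ^ 2 \<Rightarrow> real) \<Rightarrow> real ^ 2 \<Rightarrow> real" where
  "partial_deriv i f p = frechet_derivative f (at p) (axis i 1)"

text \<open>$C^\infty$ on an open set: all iterated partial derivatives are differentiable.\<close>

definition smooth_map_on :: "(real ^ 2) set \<Rightarrow> (real ^ 2 \<Rightarrow> real ^ 2) \<Rightarrow> bool" where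
  "smooth_map_on U F \<longleftrightarrow>
     (\<forall>i js. (foldr partial_deriv js (\<lambda>p. F p $ i)) differentiable_on U)"

definition area_preserving_map :: "(real ^ 2 \<Rightarrow> real ^ 2) \<Rightarrow> bool" where
  "area_preserving_map F \<longleftrightarrow>
     F 0 = 0 \<and>
     (\<exists>U. open U \<and> 0 \<in> U \<and> smooth_map_on U F \<and> (\<forall>p\<in>U. det (jacobian F (at p)) = 1))"

definition complex_eigenvalue :: "real ^ 2 ^ 2 \<Rightarrow> complex \<Rightarrow> bool" where
  "complex_eigenvalue A \<mu> \<longleftrightarrow>
     (\<exists>v :: complex ^ 2. v \<noteq> 0 \<and> map_matrix complex_of_real A *v v = \<mu> *s v)"

text \<open>The fixed point at the origin is elliptic, with eigenvalues $e^{\pm i\alpha}$ of order \<open>n\<close>.\<close>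

definition elliptic_resonant :: "(real ^ 2 \<Rightarrow> real ^ 2) \<Rightarrow> real \<Rightarrow> nat \<Rightarrow> bool" where
  "elliptic_resonant F \<alpha> n \<longleftrightarrow>
     complex_eigenvalue (jacobian F (at 0)) (cis \<alpha>) \<and> cis \<alpha> \<notin> \<real> \<and>
     0 < n \<and> cis \<alpha> ^ n = 1 \<and> (\<forall>m. 0 < m \<and> m < n \<longrightarrow> cis \<alpha> ^ m \<noteq> 1)"

text \<open>The Taylor series at the origin, in the real coordinates $(x, y)$.\<close>

definition taylor_xy :: "(real ^ 2 \<Rightarrow> real) \<Rightarrow> bifps" where
  "taylor_xy f = Abs_bifps (\<lambda>k l. complex_of_real
     ((partial_deriv 1 ^^ k) ((partial_deriv 2 ^^ l) f) 0 / (fact k * fact l)))"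

text \<open>
  The Taylor series of \<open>F\<close> as a formal map in the coordinate $z = (x + iy)/\sqrt 2$, using
  $x = (z + \bar z)/\sqrt 2$ and $y = (z - \bar z)/(i\sqrt 2)$.
\<close>

definition taylor_map :: "(real ^ 2 \<Rightarrow> real ^ 2) \<Rightarrow> bifps" where
  "taylor_map F =
     (let x = biconst (1 / complex_of_real (sqrt 2)) * (varz + varzbar);
          y = biconst (1 / (\<i> * complex_of_real (sqrt 2))) * (varz - varzbar);
          f = (\<lambda>i. bi_subst (taylor_xy (\<lambda>p. F p $ i)) x y)
      in biconst (1 / complex_of_real (sqrt 2)) * (f 1 + biconst \<i> * f 2))"

definition birkhoff_normal_form :: "(real ^ 2 \<Rightarrow> real ^ 2) \<Rightarrow> real \<Rightarrow> bifps \<Rightarrow> bool" where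
  "birkhoff_normal_form F \<alpha> N \<longleftrightarrow>
     formal_area_preserving N \<and>
     bicoeff N 1 0 = cis \<alpha> \<and> bicoeff N 0 1 = 0 \<and>
     (\<exists>C. formal_canonical_change C \<and> bi_compose C (taylor_map F) = bi_compose N C) \<and>
     bi_compose N (formal_rotation \<alpha>) = bi_compose (formal_rotation \<alpha>) N"

end

theory Submission
  imports Defs
begin

text \<open>
  Everything takes place inside the group generated by rotations and Lie series \<open>exp (ad \<eta>)\<close> of
  resonant Hamiltonians \<open>\<eta>\<close>: such maps commute with the rotation by \<open>\<alpha>\<close>, and conjugating the
  flow of \<open>H\<close> by one of them gives the flow of the transformed Hamiltonian.
  Write \<open>I = z zbar\<close> and \<open>w = z^n\<close>, and give both degree 1. Up to terms of higher degree, coming from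
  products of \<open>z^n\<close> and \<open>zbar^n\<close>, the Poisson bracket acts on polynomials in \<open>I\<close> and \<open>w\<close> and lowers
  the degree by 1, and as \<open>A 1 0 = 0\<close> the Hamiltonian starts with the quadratic form
  \<open>a I^2 + b1 I w + b2 w^2\<close>. Completing the square and rotating turns it into \<open>a I^2 + c w^2\<close>,
  where \<open>c\<close> is nonzero by the discriminant condition and can be made real.
  In degree \<open>m\<close> the homological operator \<open>a I \<partial>/\<partial>w - c w \<partial>/\<partial>I\<close>, multiplied by \<open>w\<close>, then
  reaches everything except one complex coefficient of \<open>I^(m-1) w\<close> for odd \<open>m\<close> and one real
  coefficient of \<open>I^(m-2) w^2\<close> for even \<open>m\<close>. A single generator \<open>\<eta>\<close> that normalizes all degrees at
  once is the fixed point of a contraction with respect to the degree.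
\<close>

section \<open>Series in two variables\<close>

text \<open>Against \<open>a I^2\<close> alone the homological operator reaches only monomials
  divisible by both \<open>I\<close> and \<open>w\<close>, so the pure powers of \<open>w\<close>
  stay. The term \<open>c w^2\<close> is what removes \<open>w^m\<close> for m >= 3, but in ordinary
  degree it comes after \<open>I^2\<close>; the weights put the two on the same level. Mixed
  products do no harm there, because \<open>z^n zbar^n = I^n\<close> has degree n >= 3 instead of 2.
  Counting unknowns explains the leftover. Degree m gives m complex equations for a generator with m
  - 1 complex coefficients and one real one, that of \<open>I^(m-1)\<close>; so at least one real
  coefficient survives. For odd m the operator moreover annihilates the power (m-1)/2 of the leading
  form, which costs a second real coefficient. The 8 in the discriminant condition arises because
  the coefficients of \<open>I w\<close> and \<open>w^2\<close> are half the polar amplitudes (with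
  their phases): \<open>b1^2 - 4 a b2\<close> is a quarter of the given expression.\<close>

lemma bifps_eqI:
  assumes "\<And>k l. bicoeff f k l = bicoeff g k l"
  shows "f = g"
  using assms by (auto simp: bicoeff_def fps_eq_iff)

lemma bicoeff_Abs [simp]: "bicoeff (Abs_bifps c) k l = c k l"
  by (simp add: bicoeff_def Abs_bifps_def)

lemma bicoeff_0 [simp]: "bicoeff 0 k l = 0"
  and bicoeff_add [simp]: "bicoeff (f + g) k l = bicoeff f k l + bicoeff g k l"
  and bicoeff_diff [simp]: "bicoeff (f - g) k l = bicoeff f k l - bicoeff g k l"
  and bicoeff_uminus [simp]: "bicoeff (- f) k l = - bicoeff f k l"
  by (simp_all add: bicoeff_def)

lemma bicoeff_sum [simp]: "bicoeff (sum f S) k l = (\<Sum>x\<in>S. bicoeff (f x) k l)"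
  by (simp add: bicoeff_def fps_sum_nth)

lemma bicoeff_biconst: "bicoeff (biconst c) k l = (if k = 0 \<and> l = 0 then c else 0)"
  by (simp add: bicoeff_def biconst_def)

lemma biconst_0 [simp]: "biconst 0 = 0"
  and biconst_1 [simp]: "biconst 1 = 1"
  and biconst_mult: "biconst (a * b) = biconst a * biconst b"
  by (simp_all add: biconst_def)

lemma bicoeff_1: "bicoeff 1 k l = (if k = 0 \<and> l = 0 then 1 else 0)"
  by (metis biconst_1 bicoeff_biconst)

lemma bicoeff_mult:
  "bicoeff (f * g) p q = (\<Sum>i\<le>p. \<Sum>j\<le>q. bicoeff f i j * bicoeff g (p - i) (q - j))"
  by (simp add: bicoeff_def fps_mult_nth fps_sum_nth atLeast0AtMost)

lemma bicoeff_biconst_mult [simp]: "bicoeff (biconst c * f) p q = c * bicoeff f p q"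
  by (simp add: bicoeff_def biconst_def)

lemma bicoeff_mult_biconst [simp]: "bicoeff (f * biconst c) p q = c * bicoeff f p q"
  by (simp add: mult.commute[of f])

definition bimonom :: "complex \<Rightarrow> nat \<Rightarrow> nat \<Rightarrow> bifps" where
  "bimonom c i j = Abs_bifps (\<lambda>k l. if k = i \<and> l = j then c else 0)"

lemma bicoeff_bimonom: "bicoeff (bimonom c i j) k l = (if k = i \<and> l = j then c else 0)"
  by (simp add: bimonom_def)

lemma bicoeff_bimonom_mult:
  "bicoeff (bimonom c i j * f) p q =
     (if i \<le> p \<and> j \<le> q then c * bicoeff f (p - i) (q - j) else 0)"
proof -
  have "bicoeff (bimonom c i j * f) p q =
      (\<Sum>i'\<le>p. \<Sum>j'\<le>q. (if j' = j then (if i' = i then c * bicoeff f (p - i) (q - j) else 0) else 0))"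
    unfolding bicoeff_mult by (intro sum.cong refl) (auto simp: bicoeff_bimonom)
  also have "\<dots> = (if i \<le> p \<and> j \<le> q then c * bicoeff f (p - i) (q - j) else 0)"
    by (cases "j \<le> q") (simp_all add: sum.delta)
  finally show ?thesis .
qed

lemma bimonom_mult: "bimonom a i j * bimonom b k l = bimonom (a * b) (i + k) (j + l)"
  by (rule bifps_eqI) (auto simp: bicoeff_bimonom_mult bicoeff_bimonom)

lemma biconst_eq_bimonom: "biconst c = bimonom c 0 0"
  by (rule bifps_eqI) (simp add: bicoeff_bimonom bicoeff_biconst)

lemma varz_eq_bimonom: "varz = bimonom 1 1 0"
  by (rule bifps_eqI) (simp add: bicoeff_bimonom, simp add: varz_def bicoeff_def)

lemma varzbar_eq_bimonom: "varzbar = bimonom 1 0 1"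
  by (rule bifps_eqI) (simp add: bicoeff_bimonom, simp add: varzbar_def bicoeff_def)

lemma bimonom_eq: "bimonom c i j = biconst c * varz ^ i * varzbar ^ j"
proof -
  have "varz ^ i = bimonom 1 i 0"
    by (induction i) (auto simp: varz_eq_bimonom bimonom_mult biconst_eq_bimonom simp flip: biconst_1)
  moreover have "varzbar ^ j = bimonom 1 0 j"
    by (induction j) (auto simp: varzbar_eq_bimonom bimonom_mult biconst_eq_bimonom simp flip: biconst_1)
  ultimately show ?thesis
    by (simp add: biconst_eq_bimonom bimonom_mult)
qed

lemma bicoeff_deriv_z [simp]: "bicoeff (deriv_z h) k l = of_nat (k + 1) * bicoeff h (k + 1) l"
  and bicoeff_deriv_zbar [simp]: "bicoeff (deriv_zbar h) k l = of_nat (l + 1) * bicoeff h k (l + 1)"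
  by (simp_all add: deriv_z_def deriv_zbar_def)

lemma bicoeff_conj [simp]: "bicoeff (conj_bifps h) k l = cnj (bicoeff h l k)"
  by (simp add: conj_bifps_def)

lemma deriv_z_add: "deriv_z (f + g) = deriv_z f + deriv_z g"
  and deriv_zbar_add: "deriv_zbar (f + g) = deriv_zbar f + deriv_zbar g"
  by (rule bifps_eqI, simp add: algebra_simps)+

lemma deriv_z_biconst_mult: "deriv_z (biconst c * f) = biconst c * deriv_z f"
  and deriv_zbar_biconst_mult: "deriv_zbar (biconst c * f) = biconst c * deriv_zbar f"
  by (rule bifps_eqI, simp)+

lemma deriv_z_bimonom: "deriv_z (bimonom c i j) = bimonom (of_nat i * c) (i - 1) j"
  and deriv_zbar_bimonom: "deriv_zbar (bimonom c i j) = bimonom (of_nat j * c) i (j - 1)"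
  by (rule bifps_eqI, cases i, auto simp: bicoeff_bimonom)
     (rule bifps_eqI, cases j, auto simp: bicoeff_bimonom)

lemma deriv_z_zbar: "deriv_z (deriv_zbar f) = deriv_zbar (deriv_z f)"
  by (rule bifps_eqI) (simp add: algebra_simps)

lemma deriv_z_eq_fps: "deriv_z f = fps_deriv f"
proof (rule bifps_eqI)
  fix k l
  have "of_nat (Suc k) * fps_nth f (Suc k) = fps_const (of_nat (Suc k)) * fps_nth f (Suc k)"
    by (metis fps_of_nat)
  then show "bicoeff (deriv_z f) k l = bicoeff (fps_deriv f) k l"
    by (simp add: bicoeff_def deriv_z_def Abs_bifps_def del: of_nat_Suc)
qed

lemma deriv_z_mult: "deriv_z (f * g) = deriv_z f * g + f * deriv_z g"
  by (simp add: deriv_z_eq_fps)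

lemma conj_add: "conj_bifps (f + g) = conj_bifps f + conj_bifps g"
  and conj_diff: "conj_bifps (f - g) = conj_bifps f - conj_bifps g"
  and conj_biconst: "conj_bifps (biconst c) = biconst (cnj c)"
  and conj_conj [simp]: "conj_bifps (conj_bifps f) = f"
  by (rule bifps_eqI, simp add: bicoeff_biconst)+

lemma conj_mult: "conj_bifps (f * g) = conj_bifps f * conj_bifps g"
  by (rule bifps_eqI) (simp add: bicoeff_mult, rule sum.swap)

lemma conj_1 [simp]: "conj_bifps 1 = 1"
  using conj_biconst[of 1] by simp

lemma conj_power: "conj_bifps (f ^ k) = conj_bifps f ^ k"
  by (induction k) (simp_all add: conj_mult)

lemma conj_bimonom: "conj_bifps (bimonom c i j) = bimonom (cnj c) j i"
  by (rule bifps_eqI) (auto simp: bicoeff_bimonom)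

lemma conj_varz [simp]: "conj_bifps varz = varzbar"
  by (simp add: varz_eq_bimonom varzbar_eq_bimonom conj_bimonom)

lemma conj_deriv_z: "conj_bifps (deriv_z f) = deriv_zbar (conj_bifps f)"
  and conj_deriv_zbar: "conj_bifps (deriv_zbar f) = deriv_z (conj_bifps f)"
  by (rule bifps_eqI, simp)+

lemma deriv_zbar_mult: "deriv_zbar (f * g) = deriv_zbar f * g + f * deriv_zbar g"
proof -
  have "deriv_zbar (f * g) = conj_bifps (deriv_z (conj_bifps f * conj_bifps g))"
    by (simp add: conj_deriv_z flip: conj_mult)
  also have "\<dots> = deriv_zbar f * g + f * deriv_zbar g"
    by (simp add: deriv_z_mult conj_add conj_mult conj_deriv_z)
  finally show ?thesis .
qed

subsection \<open>Supports\<close>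

text \<open>Order, resonance and weight are all bounds on the support, for different
  \<open>P\<close>; the rules for products and brackets are thus proved once.\<close>

definition bisupp :: "(nat \<Rightarrow> nat \<Rightarrow> bool) \<Rightarrow> bifps \<Rightarrow> bool" where
  "bisupp P f \<longleftrightarrow> (\<forall>k l. bicoeff f k l \<noteq> 0 \<longrightarrow> P k l)"

lemma bisuppD: "bisupp P f \<Longrightarrow> \<not> P k l \<Longrightarrow> bicoeff f k l = 0"
  by (auto simp: bisupp_def)

lemma bisuppI: "(\<And>k l. \<not> P k l \<Longrightarrow> bicoeff f k l = 0) \<Longrightarrow> bisupp P f"
  by (auto simp: bisupp_def)

lemma bisupp_mono: "bisupp P f \<Longrightarrow> (\<And>k l. P k l \<Longrightarrow> Q k l) \<Longrightarrow> bisupp Q f"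
  by (auto simp: bisupp_def)

lemma bisupp_0 [simp]: "bisupp P 0"
  by (simp add: bisupp_def)

lemma bisupp_add: "bisupp P f \<Longrightarrow> bisupp P g \<Longrightarrow> bisupp P (f + g)"
  and bisupp_diff: "bisupp P f \<Longrightarrow> bisupp P g \<Longrightarrow> bisupp P (f - g)"
  unfolding bisupp_def by (metis bicoeff_add add_0) (metis bicoeff_diff diff_self)

lemma bisupp_biconst_mult: "bisupp P f \<Longrightarrow> bisupp P (biconst c * f)"
  by (simp add: bisupp_def)

lemma bisupp_bimonom: "P i j \<Longrightarrow> bisupp P (bimonom c i j)"
  by (simp add: bisupp_def bicoeff_bimonom)

lemma bisupp_mult:
  assumes "bisupp P f" "bisupp Q g"
    and "\<And>a b c d. P a b \<Longrightarrow> Q c d \<Longrightarrow> R (a + c) (b + d)"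
  shows "bisupp R (f * g)"
proof (rule bisuppI)
  fix p q assume "\<not> R p q"
  then have "bicoeff f i j * bicoeff g (p - i) (q - j) = 0" if "i \<le> p" "j \<le> q" for i j
    using assms(3)[of i j "p - i" "q - j"] bisuppD[OF assms(1), of i j]
      bisuppD[OF assms(2), of "p - i" "q - j"] that by auto
  then show "bicoeff (f * g) p q = 0"
    unfolding bicoeff_mult by (intro sum.neutral ballI) simp
qed

lemma bisupp_deriv_z: "bisupp P f \<Longrightarrow> bisupp (\<lambda>k l. P (Suc k) l) (deriv_z f)"
  and bisupp_deriv_zbar: "bisupp P f \<Longrightarrow> bisupp (\<lambda>k l. P k (Suc l)) (deriv_zbar f)"
  by (auto simp: bisupp_def)

abbreviation ord_ge :: "nat \<Rightarrow> bifps \<Rightarrow> bool" where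
  "ord_ge m \<equiv> bisupp (\<lambda>k l. m \<le> k + l)"

lemma ord_geD: "ord_ge m f \<Longrightarrow> k + l < m \<Longrightarrow> bicoeff f k l = 0"
  using bisuppD by fastforce

lemma ord_geI: "(\<And>k l. k + l < m \<Longrightarrow> bicoeff f k l = 0) \<Longrightarrow> ord_ge m f"
  by (metis (no_types, lifting) bisuppI linorder_not_le)

lemma ord_ge_mult: "ord_ge a f \<Longrightarrow> ord_ge b g \<Longrightarrow> ord_ge (a + b) (f * g)"
  by (erule (1) bisupp_mult) auto

lemma ord_ge_mono: "ord_ge a f \<Longrightarrow> b \<le> a \<Longrightarrow> ord_ge b f"
  by (erule bisupp_mono) auto

lemma bisupp_True [simp]: "bisupp (\<lambda>k l. True) f"
  by (simp add: bisupp_def)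

lemma ord_ge_0: "ord_ge 0 f"
  by simp

lemma ord_ge_power: "ord_ge 1 u \<Longrightarrow> ord_ge k (u ^ k)"
proof (induction k)
  case (Suc k)
  then show ?case using ord_ge_mult[of 1 u k "u ^ k"] by simp
qed simp

lemma ord_ge_power_mult: "ord_ge 1 u \<Longrightarrow> ord_ge 1 v \<Longrightarrow> ord_ge (k + l) (u ^ k * v ^ l)"
  by (intro ord_ge_mult ord_ge_power)

lemma ord_ge_varz: "ord_ge 1 varz" and ord_ge_varzbar: "ord_ge 1 varzbar"
  unfolding varz_eq_bimonom varzbar_eq_bimonom by (rule bisupp_bimonom, simp)+

lemma ord_ge_1_iff: "ord_ge 1 f \<longleftrightarrow> formal_map f"
  unfolding formal_map_def bisupp_def by (metis add_is_0 less_one not_le)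

lemma bisupp_conj: "bisupp P f \<Longrightarrow> bisupp (\<lambda>k l. P l k) (conj_bifps f)"
  by (auto simp: bisupp_def)

lemma ord_ge_conj: "ord_ge m f \<Longrightarrow> ord_ge m (conj_bifps f)"
  by (drule bisupp_conj) (simp add: add.commute)

lemma ord_ge_deriv_z: "ord_ge m f \<Longrightarrow> ord_ge (m - 1) (deriv_z f)"
  and ord_ge_deriv_zbar: "ord_ge m f \<Longrightarrow> ord_ge (m - 1) (deriv_zbar f)"
  by (drule bisupp_deriv_z, erule bisupp_mono, simp) (drule bisupp_deriv_zbar, erule bisupp_mono, simp)

definition bitrunc :: "nat \<Rightarrow> bifps \<Rightarrow> bifps" where
  "bitrunc m f = (\<Sum>(k, l) \<in> {(k, l). k + l \<le> m}. bimonom (bicoeff f k l) k l)"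

lemma finite_degree_le [simp]: "finite {(k, l). k + l \<le> (m :: nat)}"
  by (rule finite_subset[of _ "{..m} \<times> {..m}"]) auto

lemma bicoeff_bitrunc: "bicoeff (bitrunc m f) p q = (if p + q \<le> m then bicoeff f p q else 0)"
proof -
  have "bicoeff (bitrunc m f) p q =
      (\<Sum>x \<in> {(k, l). k + l \<le> m}. if x = (p, q) then bicoeff f p q else 0)"
    unfolding bitrunc_def bicoeff_sum
    by (intro sum.cong refl) (auto simp: bicoeff_bimonom split: if_splits)
  then show ?thesis by (simp add: sum.delta')
qed

lemma ord_ge_diff_bitrunc: "ord_ge (Suc m) (f - bitrunc m f)"
  by (simp add: bisupp_def bicoeff_bitrunc)

text \<open>An operator that lowers the order by at most \<open>d\<close> is continuous: each
  coefficient of \<open>T f\<close> depends on a truncation of \<open>f\<close> only. Additive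
  operators of this kind may therefore be compared on monomials, which is how most identities below
  are proved.\<close>

lemma bifps_operator_eqI:
  assumes T: "Modules.additive T" "\<And>m f. ord_ge m f \<Longrightarrow> ord_ge (m - d) (T f)"
    and S: "Modules.additive S" "\<And>m f. ord_ge m f \<Longrightarrow> ord_ge (m - d) (S f)"
    and eq: "\<And>c k l. T (bimonom c k l) = S (bimonom c k l)"
  shows "T f = S f"
proof (rule bifps_eqI)
  fix p q
  let ?g = "bitrunc (p + q + d) f"
  have "T ?g = S ?g"
    unfolding bitrunc_def Modules.additive.sum[OF T(1)] Modules.additive.sum[OF S(1)]
    by (intro sum.cong refl) (auto simp: eq)
  moreover have "bicoeff (T (f - ?g)) p q = 0" "bicoeff (S (f - ?g)) p q = 0"
    using T(2)[OF ord_ge_diff_bitrunc[of "p + q + d" f]] S(2)[OF ord_ge_diff_bitrunc[of "p + q + d" f]]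
    by (simp_all add: ord_geD)
  ultimately show "bicoeff (T f) p q = bicoeff (S f) p q"
    by (simp add: Modules.additive.diff[OF T(1)] Modules.additive.diff[OF S(1)])
qed

subsection \<open>Substitution\<close>

text \<open>The range can be enlarged at will, since \<open>u ^ k * v ^ l\<close> starts in degree k
  + l. This gives different coefficients a common range.\<close>

lemma bicoeff_bi_subst:
  assumes "ord_ge 1 u" "ord_ge 1 v" "p + q \<le> N"
  shows "bicoeff (bi_subst h u v) p q =
    (\<Sum>(k, l) \<in> {(k, l). k + l \<le> N}. bicoeff h k l * bicoeff (u ^ k * v ^ l) p q)"
  unfolding bi_subst_def bicoeff_Abs
proof (rule sum.mono_neutral_left)
  show "\<forall>x \<in> {(k, l). k + l \<le> N} - {(k, l). k + l \<le> p + q}.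
      (case x of (k, l) \<Rightarrow> bicoeff h k l * bicoeff (u ^ k * v ^ l) p q) = 0"
    using ord_geD[OF ord_ge_power_mult[OF assms(1,2)], of p q] by (auto, metis linorder_not_le)
qed (use assms(3) in auto)

lemma additive_bi_subst: "Modules.additive (\<lambda>h. bi_subst h u v)"
  by (unfold_locales, rule bifps_eqI)
     (simp add: bi_subst_def sum.distrib algebra_simps case_prod_unfold)

lemma bi_subst_add: "bi_subst (f + g) u v = bi_subst f u v + bi_subst g u v"
  using additive_bi_subst Modules.additive.add by fastforce

lemma bi_subst_diff: "bi_subst (f - g) u v = bi_subst f u v - bi_subst g u v"
  using Modules.additive.diff[OF additive_bi_subst] .

lemma ord_ge_bi_subst: "ord_ge m h \<Longrightarrow> ord_ge m (bi_subst h u v)"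
  by (rule ord_geI) (auto intro!: sum.neutral simp: bi_subst_def ord_geD)

lemma bi_subst_bimonom:
  assumes "ord_ge 1 u" "ord_ge 1 v"
  shows "bi_subst (bimonom c i j) u v = biconst c * (u ^ i * v ^ j)"
proof (rule bifps_eqI)
  fix p q
  have "bicoeff (bi_subst (bimonom c i j) u v) p q =
      (\<Sum>x \<in> {(k, l). k + l \<le> p + q + i + j}.
         if x = (i, j) then c * bicoeff (u ^ i * v ^ j) p q else 0)"
    unfolding bicoeff_bi_subst[OF assms, of p q "p + q + i + j", simplified]
    by (intro sum.cong refl) (auto simp: bicoeff_bimonom split: if_splits)
  then show "bicoeff (bi_subst (bimonom c i j) u v) p q = bicoeff (biconst c * (u ^ i * v ^ j)) p q"
    by (simp add: sum.delta')
qed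

lemma bi_subst_mult:
  assumes uv: "ord_ge 1 u" "ord_ge 1 v"
  shows "bi_subst (f * g) u v = bi_subst f u v * bi_subst g u v"
proof -
  \<comment> \<open>Comparison on monomials is applied twice, first to the right factor with a
    monomial on the left, then to the left factor.\<close>
  have *: "bi_subst (bimonom c i j * g) u v = bi_subst (bimonom c i j) u v * bi_subst g u v"
    for c i j
  proof (rule bifps_operator_eqI[where d = 0 and f = g])
    show "bi_subst (bimonom c i j * bimonom b k l) u v =
        bi_subst (bimonom c i j) u v * bi_subst (bimonom b k l) u v" for b k l
      by (simp only: bimonom_mult bi_subst_bimonom[OF uv] biconst_mult power_add mult_ac)
  next
    fix m f assume f: "ord_ge m f"
    show "ord_ge (m - 0) (bi_subst (bimonom c i j * f) u v)"
      using ord_ge_mult[OF ord_ge_0 f] by (simp add: ord_ge_bi_subst)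
    show "ord_ge (m - 0) (bi_subst (bimonom c i j) u v * bi_subst f u v)"
      using ord_ge_mult[OF ord_ge_0 ord_ge_bi_subst[OF f]] by simp
  qed (unfold_locales, simp_all add: bi_subst_add distrib_left)
  show ?thesis
  proof (rule bifps_operator_eqI[where d = 0 and f = f])
    fix m f assume f: "ord_ge m f"
    show "ord_ge (m - 0) (bi_subst (f * g) u v)"
      using ord_ge_mult[OF f ord_ge_0, of g] by (simp add: ord_ge_bi_subst)
    show "ord_ge (m - 0) (bi_subst f u v * bi_subst g u v)"
      using ord_ge_mult[OF ord_ge_bi_subst[OF f] ord_ge_0] by simp
  qed (unfold_locales, simp_all add: bi_subst_add distrib_right *)
qed

lemma bi_subst_biconst: "bi_subst (biconst c) u v = biconst c"
proof (rule bifps_eqI)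
  fix p q
  have "bicoeff (bi_subst (biconst c) u v) p q =
    (\<Sum>x \<in> {(k, l). k + l \<le> p + q}. if x = (0, 0) then c * bicoeff 1 p q else 0)"
    unfolding bi_subst_def bicoeff_Abs by (intro sum.cong refl) (auto simp: bicoeff_biconst split: if_splits)
  then show "bicoeff (bi_subst (biconst c) u v) p q = bicoeff (biconst c) p q"
    by (simp add: sum.delta' bicoeff_1 bicoeff_biconst)
qed

lemma bi_subst_1 [simp]: "bi_subst 1 u v = 1"
  using bi_subst_biconst[of 1] by simp

lemma bi_subst_varz [simp]: "ord_ge 1 u \<Longrightarrow> ord_ge 1 v \<Longrightarrow> bi_subst varz u v = u"
  and bi_subst_varzbar [simp]: "ord_ge 1 u \<Longrightarrow> ord_ge 1 v \<Longrightarrow> bi_subst varzbar u v = v"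
  by (simp_all add: varz_eq_bimonom varzbar_eq_bimonom bi_subst_bimonom)

text \<open>Continuous algebra endomorphisms are substitutions. This yields associativity of
  substitution, and it turns a Lie series, defined as an operator, into composition with a formal
  map.\<close>

lemma algebra_hom_eq_bi_subst:
  assumes T: "Modules.additive T" "\<And>m f. ord_ge m f \<Longrightarrow> ord_ge m (T f)"
    and mult: "\<And>f g. T (f * g) = T f * T g" and const: "\<And>c. T (biconst c) = biconst c"
  shows "T f = bi_subst f (T varz) (T varzbar)"
proof -
  have uv: "ord_ge 1 (T varz)" "ord_ge 1 (T varzbar)"
    using T(2) ord_ge_varz ord_ge_varzbar by blast+
  have power: "T (f ^ k) = T f ^ k" for f k
    by (induction k) (use const[of 1] in \<open>simp_all add: mult\<close>)
  show ?thesis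
  proof (rule bifps_operator_eqI[where d = 0 and f = f])
    show "T (bimonom c k l) = bi_subst (bimonom c k l) (T varz) (T varzbar)" for c k l
      by (simp only: bi_subst_bimonom[OF uv]) (simp add: bimonom_eq mult const power mult.assoc)
  qed (simp_all add: T additive_bi_subst ord_ge_bi_subst)
qed

lemma bi_subst_bi_subst:
  assumes "ord_ge 1 u" "ord_ge 1 v" "ord_ge 1 u'" "ord_ge 1 v'"
  shows "bi_subst (bi_subst h u v) u' v' = bi_subst h (bi_subst u u' v') (bi_subst v u' v')"
proof -
  have "Modules.additive (\<lambda>h. bi_subst (bi_subst h u v) u' v')"
    by unfold_locales (simp add: bi_subst_add)
  from algebra_hom_eq_bi_subst[OF this, of h] assms show ?thesis
    by (simp add: bi_subst_mult bi_subst_biconst ord_ge_bi_subst)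
qed

lemma bi_subst_varz_varzbar [simp]: "bi_subst h varz varzbar = h"
  using algebra_hom_eq_bi_subst[of "\<lambda>h. h" h] by (simp add: Modules.additive_def)

lemma conj_bi_subst:
  assumes "ord_ge 1 u" "ord_ge 1 v"
  shows "conj_bifps (bi_subst h u v) = bi_subst (conj_bifps h) (conj_bifps v) (conj_bifps u)"
proof (rule bifps_operator_eqI[where d = 0 and f = h])
  show "ord_ge (m - 0) (conj_bifps (bi_subst f u v))" if "ord_ge m f" for m f
    using that by (simp add: ord_ge_bi_subst ord_ge_conj)
  show "ord_ge (m - 0) (bi_subst (conj_bifps f) (conj_bifps v) (conj_bifps u))" if "ord_ge m f" for m f
    using that by (simp add: ord_ge_bi_subst ord_ge_conj)
  show "conj_bifps (bi_subst (bimonom c k l) u v) =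
      bi_subst (conj_bifps (bimonom c k l)) (conj_bifps v) (conj_bifps u)" for c k l
    using assms by (simp add: bi_subst_bimonom conj_bimonom ord_ge_conj conj_mult conj_power
        conj_biconst mult.commute)
qed (unfold_locales, simp_all add: bi_subst_add conj_add)

text \<open>The chain rule for an arbitrary continuous derivation, so that both partial derivatives
  are covered. The comparison uses \<open>d + 1\<close> because the partial derivatives of
  \<open>h\<close> lose one order as well.\<close>

lemma derivation_bi_subst:
  assumes \<delta>: "Modules.additive \<delta>" "\<And>m f. ord_ge m f \<Longrightarrow> ord_ge (m - d) (\<delta> f)"
    and mult: "\<And>f g. \<delta> (f * g) = \<delta> f * g + f * \<delta> g" and const: "\<And>c. \<delta> (biconst c) = 0"
    and uv: "ord_ge 1 u" "ord_ge 1 v"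
  shows "\<delta> (bi_subst h u v) = bi_subst (deriv_z h) u v * \<delta> u + bi_subst (deriv_zbar h) u v * \<delta> v"
proof (rule bifps_operator_eqI[where d = "d + 1" and f = h])
  have power: "\<delta> (f ^ k) = of_nat k * f ^ (k - 1) * \<delta> f" for f k
  proof (induction k)
    case 0
    show ?case using const[of 1] by simp
  next
    case (Suc k)
    then show ?case by (cases k) (simp_all add: mult algebra_simps)
  qed
  have nat: "of_nat k = biconst (of_nat k)" for k
    by (simp add: biconst_def fps_of_nat)
  show "\<delta> (bi_subst (bimonom c k l) u v) =
    bi_subst (deriv_z (bimonom c k l)) u v * \<delta> u + bi_subst (deriv_zbar (bimonom c k l)) u v * \<delta> v" for c k l
    by (simp only: bi_subst_bimonom[OF uv] deriv_z_bimonom deriv_zbar_bimonom biconst_mult mult const power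
        flip: nat) (simp add: algebra_simps)
next
  fix m f assume f: "ord_ge m f"
  show "ord_ge (m - (d + 1)) (\<delta> (bi_subst f u v))"
    using \<delta>(2)[OF ord_ge_bi_subst[OF f]] by (rule ord_ge_mono) simp
  have "ord_ge (m - 1 + 0) (bi_subst (deriv_z f) u v * \<delta> u)"
    "ord_ge (m - 1 + 0) (bi_subst (deriv_zbar f) u v * \<delta> v)"
    using f by (intro ord_ge_mult ord_ge_bi_subst ord_ge_deriv_z ord_ge_deriv_zbar ord_ge_0; simp)+
  then show "ord_ge (m - (d + 1)) (bi_subst (deriv_z f) u v * \<delta> u + bi_subst (deriv_zbar f) u v * \<delta> v)"
    by (intro bisupp_add) (erule ord_ge_mono, simp)+
qed (unfold_locales, simp_all add: bi_subst_add deriv_z_add deriv_zbar_add Modules.additive.add[OF \<delta>(1)] distrib_right)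

lemma deriv_z_biconst [simp]: "deriv_z (biconst c) = 0"
  and deriv_zbar_biconst [simp]: "deriv_zbar (biconst c) = 0"
  by (rule bifps_eqI, simp add: bicoeff_biconst)+

lemma
  assumes uv: "ord_ge 1 u" "ord_ge 1 v"
  shows deriv_z_bi_subst: "deriv_z (bi_subst h u v) =
      bi_subst (deriv_z h) u v * deriv_z u + bi_subst (deriv_zbar h) u v * deriv_z v"
    and deriv_zbar_bi_subst: "deriv_zbar (bi_subst h u v) =
      bi_subst (deriv_z h) u v * deriv_zbar u + bi_subst (deriv_zbar h) u v * deriv_zbar v"
  using uv
  by (intro derivation_bi_subst[where d = 1] ord_ge_deriv_z ord_ge_deriv_zbar;
      simp add: Modules.additive_def deriv_z_add deriv_zbar_add deriv_z_mult deriv_zbar_mult)+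

section \<open>Poisson brackets and Lie series\<close>

text \<open>Without a scalar factor, so that the bracket of \<open>z\<close> and \<open>zbar\<close>
  is 1. The bracket of real-valued series is then purely imaginary, which the factor -i in
  \<open>ham_deriv\<close> repairs.\<close>

definition poisson :: "bifps \<Rightarrow> bifps \<Rightarrow> bifps" where
  "poisson f g = deriv_z f * deriv_zbar g - deriv_zbar f * deriv_z g"

lemma formal_jacobian_eq_poisson: "formal_jacobian f = poisson f (conj_bifps f)"
  by (simp add: formal_jacobian_def poisson_def)

lemma deriv_z_diff: "deriv_z (f - g) = deriv_z f - deriv_z g"
  and deriv_zbar_diff: "deriv_zbar (f - g) = deriv_zbar f - deriv_zbar g"
  by (rule bifps_eqI, simp add: algebra_simps)+

lemma poisson_add_left: "poisson (f + g) h = poisson f h + poisson g h"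
  and poisson_add_right: "poisson h (f + g) = poisson h f + poisson h g"
  and poisson_diff_left: "poisson (f - g) h = poisson f h - poisson g h"
  and poisson_diff_right: "poisson h (f - g) = poisson h f - poisson h g"
  by (simp_all add: poisson_def deriv_z_add deriv_zbar_add deriv_z_diff deriv_zbar_diff algebra_simps)

lemma poisson_biconst_mult_left: "poisson (biconst c * f) g = biconst c * poisson f g"
  and poisson_biconst_mult_right: "poisson f (biconst c * g) = biconst c * poisson f g"
  by (simp_all only: poisson_def deriv_z_biconst_mult deriv_zbar_biconst_mult) (simp_all add: algebra_simps)

lemma poisson_biconst_left [simp]: "poisson (biconst c) g = 0"
  by (simp add: poisson_def)

lemma poisson_mult_left: "poisson (f * g) h = poisson f h * g + f * poisson g h"
  by (simp add: poisson_def deriv_z_mult deriv_zbar_mult algebra_simps)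

lemma poisson_jacobi: "poisson (poisson f g) h = poisson (poisson f h) g + poisson f (poisson g h)"
  by (simp add: poisson_def deriv_z_mult deriv_zbar_mult deriv_z_diff deriv_zbar_diff
      deriv_z_zbar algebra_simps)

lemma conj_poisson: "conj_bifps (poisson f g) = - poisson (conj_bifps f) (conj_bifps g)"
  by (simp add: poisson_def conj_diff conj_mult conj_deriv_z conj_deriv_zbar)

lemma poisson_varz_varzbar: "poisson varz varzbar = 1"
  by (rule bifps_eqI)
    (simp add: poisson_def varz_eq_bimonom varzbar_eq_bimonom deriv_z_bimonom deriv_zbar_bimonom
      bimonom_mult bicoeff_bimonom bicoeff_1)

lemma bisupp_poisson:
  assumes "bisupp P f" "bisupp Q g"
    and "\<And>a b c d k l. P a b \<Longrightarrow> Q c d \<Longrightarrow> a + c = Suc k \<Longrightarrow> b + d = Suc l \<Longrightarrow> R k l"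
  shows "bisupp R (poisson f g)"
  unfolding poisson_def
proof (rule bisupp_diff)
  show "bisupp R (deriv_z f * deriv_zbar g)"
    by (rule bisupp_mult[OF bisupp_deriv_z[OF assms(1)] bisupp_deriv_zbar[OF assms(2)]])
      (rule assms(3), auto)
  show "bisupp R (deriv_zbar f * deriv_z g)"
    by (rule bisupp_mult[OF bisupp_deriv_zbar[OF assms(1)] bisupp_deriv_z[OF assms(2)]])
      (rule assms(3), auto)
qed

lemma poisson_bi_subst:
  assumes "ord_ge 1 u" "ord_ge 1 v"
  shows "poisson (bi_subst f u v) (bi_subst g u v) = bi_subst (poisson f g) u v * poisson u v"
  using assms
  by (simp add: poisson_def deriv_z_bi_subst deriv_zbar_bi_subst bi_subst_diff bi_subst_mult algebra_simps)

text \<open>The time derivative of \<open>f\<close> along the flow of the Hamiltonian \<open>\<eta>\<close>.\<close>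

definition ham_deriv :: "bifps \<Rightarrow> bifps \<Rightarrow> bifps" where
  "ham_deriv \<eta> f = biconst (- \<i>) * poisson f \<eta>"

lemma ham_deriv_add: "ham_deriv \<eta> (f + g) = ham_deriv \<eta> f + ham_deriv \<eta> g"
  and ham_deriv_diff: "ham_deriv \<eta> (f - g) = ham_deriv \<eta> f - ham_deriv \<eta> g"
  and ham_deriv_diff_left: "ham_deriv (\<eta> - \<eta>') f = ham_deriv \<eta> f - ham_deriv \<eta>' f"
  and ham_deriv_biconst_mult: "ham_deriv \<eta> (biconst c * f) = biconst c * ham_deriv \<eta> f"
  and ham_deriv_biconst [simp]: "ham_deriv \<eta> (biconst c) = 0"
  and ham_deriv_mult: "ham_deriv \<eta> (f * g) = ham_deriv \<eta> f * g + f * ham_deriv \<eta> g"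
  by (simp_all add: ham_deriv_def poisson_add_left poisson_diff_left poisson_diff_right
      poisson_biconst_mult_left poisson_mult_left algebra_simps)

lemma ham_deriv_0 [simp]: "ham_deriv \<eta> 0 = 0"
  using ham_deriv_biconst[of \<eta> 0] by simp

lemma ham_deriv_sum: "ham_deriv \<eta> (sum f S) = (\<Sum>x\<in>S. ham_deriv \<eta> (f x))"
  by (induction S rule: infinite_finite_induct) (simp_all add: ham_deriv_add)

lemma ham_deriv_uminus_left: "ham_deriv (- \<eta>) f = - ham_deriv \<eta> f"
  using ham_deriv_diff_left[of 0 \<eta> f] ham_deriv_diff_left[of 0 0 f] by simp

lemma ham_deriv_poisson:
  "ham_deriv \<eta> (poisson f g) = poisson (ham_deriv \<eta> f) g + poisson f (ham_deriv \<eta> g)"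
  unfolding ham_deriv_def poisson_jacobi[of f g \<eta>] poisson_biconst_mult_left poisson_biconst_mult_right
  by (simp add: algebra_simps)

lemma conj_ham_deriv:
  "real_valued \<eta> \<Longrightarrow> conj_bifps (ham_deriv \<eta> f) = ham_deriv \<eta> (conj_bifps f)"
  by (rule bifps_eqI)
    (simp add: ham_deriv_def conj_mult conj_biconst conj_poisson real_valued_def del: bicoeff_conj)

lemma bisupp_ham_deriv:
  assumes "bisupp P f" "bisupp Q \<eta>"
    and "\<And>a b c d k l. P a b \<Longrightarrow> Q c d \<Longrightarrow> a + c = Suc k \<Longrightarrow> b + d = Suc l \<Longrightarrow> R k l"
  shows "bisupp R (ham_deriv \<eta> f)"
  unfolding ham_deriv_def using assms by (intro bisupp_biconst_mult bisupp_poisson)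

lemma ord_ge_ham_deriv: "ord_ge 3 \<eta> \<Longrightarrow> ord_ge m f \<Longrightarrow> ord_ge (Suc m) (ham_deriv \<eta> f)"
  by (rule bisupp_ham_deriv[where P = "\<lambda>k l. m \<le> k + l" and Q = "\<lambda>k l. 3 \<le> k + l"]) auto

section \<open>Lie series as automorphisms of the product and of the bracket\<close>

definition lie_term :: "bifps \<Rightarrow> nat \<Rightarrow> bifps \<Rightarrow> bifps" where
  "lie_term \<eta> k f = biconst (1 / fact k) * (ham_deriv \<eta> ^^ k) f"

text \<open>The pullback of functions by the time-one flow of \<open>\<eta>\<close>. If
  \<open>\<eta>\<close> has order at least 3, every \<open>ham_deriv\<close> raises the order by
  one, and the cut at \<open>p + q\<close> is exact.\<close>

definition lie_exp :: "bifps \<Rightarrow> bifps \<Rightarrow> bifps" where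
  "lie_exp \<eta> f = Abs_bifps (\<lambda>p q. \<Sum>k\<le>p + q. bicoeff (lie_term \<eta> k f) p q)"

lemma lie_term_0 [simp]: "lie_term \<eta> 0 f = f"
  by (simp add: lie_term_def)

lemma ham_deriv_lie_term: "ham_deriv \<eta> (lie_term \<eta> k f) = biconst (of_nat (Suc k)) * lie_term \<eta> (Suc k) f"
proof -
  have "1 / fact k = of_nat (Suc k) * (1 / fact (Suc k) :: complex)"
    by (simp del: of_nat_Suc)
  then show ?thesis
    unfolding lie_term_def ham_deriv_biconst_mult mult.assoc[symmetric] biconst_mult[symmetric]
    by simp
qed

lemma lie_term_Suc: "lie_term \<eta> (Suc k) f = biconst (1 / of_nat (Suc k)) * ham_deriv \<eta> (lie_term \<eta> k f)"
  by (rule bifps_eqI) (simp add: ham_deriv_lie_term field_simps del: of_nat_Suc)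

lemma bisupp_lie_term:
  assumes "bisupp (P 0) f" and "\<And>k f. bisupp (P k) f \<Longrightarrow> bisupp (P (Suc k)) (ham_deriv \<eta> f)"
  shows "bisupp (P k) (lie_term \<eta> k f)"
  by (induction k) (simp_all add: lie_term_Suc bisupp_biconst_mult assms)

lemma bisupp_lie_exp:
  assumes "\<And>k. bisupp P (lie_term \<eta> k f)"
  shows "bisupp P (lie_exp \<eta> f)"
  unfolding lie_exp_def by (rule bisuppI) (simp add: sum.neutral bisuppD[OF assms])

lemma additive_ham_deriv_funpow: "(ham_deriv \<eta> ^^ k) (f + g) = (ham_deriv \<eta> ^^ k) f + (ham_deriv \<eta> ^^ k) g"
  by (induction k) (simp_all add: ham_deriv_add)

lemma lie_term_add: "lie_term \<eta> k (f + g) = lie_term \<eta> k f + lie_term \<eta> k g"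
  by (simp add: lie_term_def additive_ham_deriv_funpow distrib_left)

lemma lie_exp_add: "lie_exp \<eta> (f + g) = lie_exp \<eta> f + lie_exp \<eta> g"
  by (rule bifps_eqI) (simp add: lie_exp_def lie_term_add sum.distrib)

lemma conj_lie_exp:
  assumes "real_valued \<eta>"
  shows "conj_bifps (lie_exp \<eta> f) = lie_exp \<eta> (conj_bifps f)"
proof -
  have "(ham_deriv \<eta> ^^ k) (conj_bifps f) = conj_bifps ((ham_deriv \<eta> ^^ k) f)" for k
    by (induction k) (simp_all add: conj_ham_deriv[OF assms])
  then show ?thesis
    by (intro bifps_eqI) (simp add: lie_exp_def lie_term_def add.commute)
qed

lemma bicoeff_triangle_sum:
  assumes "\<And>i j. ord_ge (i + j - d) (F i j)"
  shows "(\<Sum>i\<le>p + q + d. \<Sum>j\<le>p + q + d. bicoeff (F i j) p q) =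
    (\<Sum>k\<le>p + q + d. \<Sum>i\<le>k. bicoeff (F i (k - i)) p q)"
proof -
  let ?N = "p + q + d"
  have "bicoeff (F i j) p q = 0" if "i + j > ?N" for i j
    using that by (intro ord_geD[OF assms]) simp
  then have "(\<Sum>i\<le>?N. \<Sum>j\<le>?N. bicoeff (F i j) p q) =
      (\<Sum>(i, j) \<in> {(i, j). i + j \<le> ?N}. bicoeff (F i j) p q)"
    unfolding sum.cartesian_product
    by (intro sum.mono_neutral_right) (auto, metis linorder_not_le)
  then show ?thesis
    by (simp add: sum.triangle_reindex_eq)
qed

context
  fixes \<eta> :: bifps
  assumes \<eta>: "ord_ge 3 \<eta>"
begin

lemma ord_ge_lie_term: "ord_ge m f \<Longrightarrow> ord_ge (m + k) (lie_term \<eta> k f)"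
  by (rule bisupp_lie_term[where P = "\<lambda>k a b. m + k \<le> a + b"]) (auto dest: ord_ge_ham_deriv[OF \<eta>])

lemma ord_ge_lie_exp: "ord_ge m f \<Longrightarrow> ord_ge m (lie_exp \<eta> f)"
  by (rule bisupp_lie_exp) (rule ord_ge_mono[OF ord_ge_lie_term], auto)

lemma bicoeff_lie_exp:
  assumes "p + q \<le> N"
  shows "bicoeff (lie_exp \<eta> f) p q = (\<Sum>k\<le>N. bicoeff (lie_term \<eta> k f) p q)"
  unfolding lie_exp_def bicoeff_Abs
  by (rule sum.mono_neutral_left) (use assms ord_geD[OF ord_ge_lie_term[OF ord_ge_0]] in auto)

lemma ord_ge_lie_exp_diff: "ord_ge (Suc N) (lie_exp \<eta> f - (\<Sum>k\<le>N. lie_term \<eta> k f))"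
  by (rule ord_geI) (simp add: bicoeff_lie_exp)

text \<open>If \<open>ham_deriv\<close> is a derivation of a bilinear operation, the Leibniz formula
  for its powers makes the exponential multiplicative. Product and bracket are both instances;
  \<open>d\<close> is the order they lose, 0 and 2.\<close>

lemma lie_exp_bilinear:
  assumes add: "\<And>f f' g. B (f + f') g = B f g + B f' g" "\<And>f g g'. B f (g + g') = B f g + B f g'"
    and scale: "\<And>c f g. B (biconst c * f) g = biconst c * B f g"
      "\<And>c f g. B f (biconst c * g) = biconst c * B f g"
    and ord: "\<And>a b f g. ord_ge a f \<Longrightarrow> ord_ge b g \<Longrightarrow> ord_ge (a + b - d) (B f g)"
    and deriv: "\<And>f g. ham_deriv \<eta> (B f g) = B (ham_deriv \<eta> f) g + B f (ham_deriv \<eta> g)"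
  shows "lie_exp \<eta> (B f g) = B (lie_exp \<eta> f) (lie_exp \<eta> g)"
proof (rule bifps_eqI)
  fix p q
  let ?t = "lie_term \<eta>" and ?N = "p + q + d"
  have left: "Modules.additive (\<lambda>f. B f g)" and right: "Modules.additive (B f)" for f g
    by (simp_all add: Modules.additive_def add)
  have leibniz: "bicoeff (?t k (B f g)) p q = (\<Sum>i\<le>k. bicoeff (B (?t i f) (?t (k - i) g)) p q)" for k p q
  proof (induction k arbitrary: p q)
    case (Suc k)
    let ?b = "\<lambda>i j. bicoeff (B (?t i f) (?t j g)) p q"
    have "?t k (B f g) = (\<Sum>i\<le>k. B (?t i f) (?t (k - i) g))"
      by (rule bifps_eqI) (simp add: Suc.IH)
    then have "of_nat (Suc k) * bicoeff (?t (Suc k) (B f g)) p q =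
        (\<Sum>i\<le>k. of_nat (Suc i) * ?b (Suc i) (k - i)) + (\<Sum>i\<le>k. of_nat (Suc (k - i)) * ?b i (Suc (k - i)))"
      by (simp add: lie_term_Suc ham_deriv_sum deriv sum.distrib del: of_nat_Suc)
        (simp add: ham_deriv_lie_term scale sum.distrib del: of_nat_Suc)
    also have "(\<Sum>i\<le>k. of_nat (Suc i) * ?b (Suc i) (k - i)) = (\<Sum>i\<le>Suc k. of_nat i * ?b i (Suc k - i))"
      by (simp add: sum.atMost_Suc_shift del: of_nat_Suc sum.atMost_Suc)
    also have "(\<Sum>i\<le>k. of_nat (Suc (k - i)) * ?b i (Suc (k - i))) =
        (\<Sum>i\<le>Suc k. of_nat (Suc k - i) * ?b i (Suc k - i))"
      by (simp add: Suc_diff_le del: of_nat_Suc of_nat_diff)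
    also have "(\<Sum>i\<le>Suc k. of_nat i * ?b i (Suc k - i)) + (\<Sum>i\<le>Suc k. of_nat (Suc k - i) * ?b i (Suc k - i)) =
        (\<Sum>i\<le>Suc k. of_nat (Suc k) * ?b i (Suc k - i))"
      unfolding sum.distrib[symmetric]
      by (intro sum.cong refl) (simp add: of_nat_diff algebra_simps)
    finally show ?case
      by (simp only: sum_distrib_left[symmetric]) (simp del: of_nat_Suc sum.atMost_Suc)
  qed simp
  let ?f = "\<Sum>k\<le>?N. ?t k f" and ?g = "\<Sum>k\<le>?N. ?t k g"
  \<comment> \<open>Both series are replaced by partial sums one argument at a time, and each error
    has order beyond \<open>p + q\<close>.\<close>
  have "ord_ge (Suc ?N + 0 - d) (B (lie_exp \<eta> f - ?f) (lie_exp \<eta> g))"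
    "ord_ge (0 + Suc ?N - d) (B ?f (lie_exp \<eta> g - ?g))"
    by (intro ord ord_ge_lie_exp_diff ord_ge_0)+
  then have "bicoeff (B (lie_exp \<eta> f - ?f) (lie_exp \<eta> g)) p q = 0"
    "bicoeff (B ?f (lie_exp \<eta> g - ?g)) p q = 0"
    by (auto elim!: ord_geD)
  then have "bicoeff (B (lie_exp \<eta> f) (lie_exp \<eta> g)) p q = bicoeff (B ?f ?g) p q"
    by (simp add: Modules.additive.diff[OF left] Modules.additive.diff[OF right])
  also have "\<dots> = (\<Sum>i\<le>?N. \<Sum>j\<le>?N. bicoeff (B (?t i f) (?t j g)) p q)"
    by (simp add: Modules.additive.sum[OF left] Modules.additive.sum[OF right]) (rule sum.swap)
  also have "\<dots> = (\<Sum>k\<le>?N. \<Sum>i\<le>k. bicoeff (B (?t i f) (?t (k - i) g)) p q)"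
    using ord[OF ord_ge_lie_term[OF ord_ge_0] ord_ge_lie_term[OF ord_ge_0]]
    by (intro bicoeff_triangle_sum) simp
  also have "\<dots> = bicoeff (lie_exp \<eta> (B f g)) p q"
    unfolding leibniz[symmetric] by (rule bicoeff_lie_exp[symmetric]) simp
  finally show "bicoeff (lie_exp \<eta> (B f g)) p q = bicoeff (B (lie_exp \<eta> f) (lie_exp \<eta> g)) p q" ..
qed

lemma lie_exp_mult: "lie_exp \<eta> (f * g) = lie_exp \<eta> f * lie_exp \<eta> g"
proof (rule lie_exp_bilinear[where d = 0])
  show "ord_ge (a + b - 0) (f * g)" if "ord_ge a f" "ord_ge b g" for a b f g
    using ord_ge_mult[OF that] by simp
qed (simp_all add: algebra_simps ham_deriv_mult)

lemma lie_exp_poisson: "lie_exp \<eta> (poisson f g) = poisson (lie_exp \<eta> f) (lie_exp \<eta> g)"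
proof (rule lie_exp_bilinear[where d = 2])
  show "ord_ge (a + b - 2) (poisson f g)" if "ord_ge a f" "ord_ge b g" for a b f g
    using that by (rule bisupp_poisson) auto
qed (simp_all add: poisson_add_left poisson_add_right poisson_biconst_mult_left
    poisson_biconst_mult_right ham_deriv_poisson)

lemma lie_exp_biconst: "lie_exp \<eta> (biconst c) = biconst c"
proof (rule bifps_eqI)
  fix p q
  have "lie_term \<eta> (Suc k) (biconst c) = 0" for k
    by (induction k) (simp_all only: lie_term_Suc lie_term_0 ham_deriv_biconst ham_deriv_0 mult_zero_right)
  then have "bicoeff (lie_term \<eta> k (biconst c)) p q = (if k = 0 then bicoeff (biconst c) p q else 0)" for k
    by (cases k) simp_all
  then show "bicoeff (lie_exp \<eta> (biconst c)) p q = bicoeff (biconst c) p q"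
    by (simp add: lie_exp_def)
qed

text \<open>After collecting terms by the total number k of brackets, the factor is the alternating
  sum of the binomial coefficients of k, which vanishes unless k = 0.\<close>

lemma lie_exp_uminus_lie_exp: "lie_exp (- \<eta>) (lie_exp \<eta> f) = f"
proof (rule bifps_eqI)
  fix p q :: nat
  let ?t = "lie_term \<eta>" and ?N = "p + q"
  have \<eta>': "ord_ge 3 (- \<eta>)"
    using bisupp_diff[OF bisupp_0 \<eta>] by simp
  have funpow: "(ham_deriv (- \<eta>) ^^ i) g = biconst ((- 1) ^ i) * (ham_deriv \<eta> ^^ i) g" for i g
  proof (induction i)
    case (Suc i)
    show ?case
      using Suc by (intro bifps_eqI) (simp add: ham_deriv_uminus_left[of \<eta> "(_ ^^ _) _"] ham_deriv_biconst_mult)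
  qed simp
  then have uminus: "bicoeff (lie_term (- \<eta>) i (?t j f)) r s =
      (-1) ^ i * of_nat (i + j choose i) * bicoeff (?t (i + j) f) r s" for i j r s
  proof -
    have scale: "(ham_deriv \<eta> ^^ i) (biconst c * g) = biconst c * (ham_deriv \<eta> ^^ i) g" for c g
      by (induction i) (simp_all add: ham_deriv_biconst_mult)
    have "of_nat (i + j choose i) = (fact (i + j) / (fact i * fact j) :: complex)"
      by (simp add: binomial_fact)
    then show ?thesis
      by (simp add: lie_term_def funpow scale funpow_add)
  qed
  have add: "Modules.additive (lie_term (- \<eta>) i)" for i
    by (simp add: Modules.additive_def lie_term_add)
  have "ord_ge (Suc ?N + i) (lie_term (- \<eta>) i (lie_exp \<eta> f - (\<Sum>j\<le>?N. ?t j f)))" for i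
    by (rule bisupp_lie_term[where P = "\<lambda>k a b. Suc ?N + k \<le> a + b"])
      (use ord_ge_lie_exp_diff[of ?N f] in \<open>auto dest: ord_ge_ham_deriv[OF \<eta>']\<close>)
  then have "bicoeff (lie_term (- \<eta>) i (lie_exp \<eta> f - (\<Sum>j\<le>?N. ?t j f))) p q = 0" for i
    by (rule ord_geD) simp
  then have "bicoeff (lie_term (- \<eta>) i (lie_exp \<eta> f)) p q = (\<Sum>j\<le>?N. bicoeff (lie_term (- \<eta>) i (?t j f)) p q)" for i
    by (simp add: Modules.additive.diff[OF add] Modules.additive.sum[OF add])
  then have "bicoeff (lie_exp (- \<eta>) (lie_exp \<eta> f)) p q =
      (\<Sum>i\<le>?N. \<Sum>j\<le>?N. bicoeff (lie_term (- \<eta>) i (?t j f)) p q)"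
    by (simp add: lie_exp_def)
  also have "\<dots> = (\<Sum>k\<le>?N. \<Sum>i\<le>k. bicoeff (lie_term (- \<eta>) i (?t (k - i) f)) p q)"
  proof (rule bicoeff_triangle_sum[where d = 0, simplified])
    fix i j
    show "ord_ge (i + j) (lie_term (- \<eta>) i (?t j f))"
      by (rule ord_geI) (use ord_geD[OF ord_ge_lie_term[OF ord_ge_0], of _ _ "i + j" f] in \<open>simp add: uminus\<close>)
  qed
  also have "\<dots> = (\<Sum>k\<le>?N. if k = 0 then bicoeff f p q else 0)"
  proof (rule sum.cong[OF refl])
    fix k
    have "(\<Sum>i\<le>k. bicoeff (lie_term (- \<eta>) i (?t (k - i) f)) p q) =
        (\<Sum>i\<le>k. (-1) ^ i * of_nat (k choose i)) * bicoeff (?t k f) p q"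
      by (simp add: uminus sum_distrib_right)
    also have "\<dots> = (if k = 0 then bicoeff f p q else 0)"
      using choose_alternating_sum[of k, where ?'a = complex] by (cases "k = 0") (simp_all add: uminus)
    finally show "(\<Sum>i\<le>k. bicoeff (lie_term (- \<eta>) i (?t (k - i) f)) p q) =
        (if k = 0 then bicoeff f p q else 0)" .
  qed
  finally show "bicoeff (lie_exp (- \<eta>) (lie_exp \<eta> f)) p q = bicoeff f p q"
    by simp
qed

lemma lie_exp_eq_bi_compose:
  assumes "real_valued \<eta>"
  shows "lie_exp \<eta> f = bi_compose f (lie_exp \<eta> varz)"
proof -
  have "lie_exp \<eta> f = bi_subst f (lie_exp \<eta> varz) (lie_exp \<eta> varzbar)"
    by (rule algebra_hom_eq_bi_subst)
      (simp_all add: Modules.additive_def lie_exp_add ord_ge_lie_exp lie_exp_mult lie_exp_biconst)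
  then show ?thesis
    by (simp add: bi_compose_def conj_lie_exp[OF assms])
qed

text \<open>The Jacobian is the bracket of the images of \<open>z\<close> and \<open>zbar\<close>,
  and the exponential preserves brackets and constants.\<close>

lemma formal_area_preserving_lie_exp:
  assumes "real_valued \<eta>"
  shows "formal_area_preserving (lie_exp \<eta> varz)"
  using lie_exp_poisson[of varz varzbar] lie_exp_biconst[of 1] ord_ge_lie_exp[OF ord_ge_varz]
  by (simp add: formal_area_preserving_def formal_jacobian_eq_poisson conj_lie_exp[OF assms]
      poisson_varz_varzbar ord_ge_1_iff[simplified])

end

section \<open>Formal maps and flows\<close>

lemma formal_map_ord_ge: "formal_map f \<Longrightarrow> ord_ge 1 f"
  using ord_ge_1_iff by blast

lemma formal_map_conj: "formal_map f \<Longrightarrow> formal_map (conj_bifps f)"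
  by (simp add: formal_map_def)

lemma formal_map_varz: "formal_map varz"
  using ord_ge_varz ord_ge_1_iff by blast

lemma formal_map_bi_compose: "formal_map f \<Longrightarrow> formal_map (bi_compose f g)"
  unfolding bi_compose_def using ord_ge_bi_subst ord_ge_1_iff by blast

lemma ord_ge_1_compose:
  assumes "formal_map f"
  shows "ord_ge 1 f" "ord_ge 1 (conj_bifps f)"
  using assms by (simp_all add: formal_map_ord_ge[simplified] formal_map_conj)

lemma conj_bi_compose: "formal_map f \<Longrightarrow> conj_bifps (bi_compose h f) = bi_compose (conj_bifps h) f"
  unfolding bi_compose_def by (subst conj_bi_subst) (simp_all add: ord_ge_1_compose[simplified])

lemma bi_compose_assoc:
  "formal_map f \<Longrightarrow> formal_map g \<Longrightarrow> bi_compose (bi_compose h f) g = bi_compose h (bi_compose f g)"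
  using conj_bi_compose[of g f]
  by (simp add: bi_compose_def bi_subst_bi_subst ord_ge_1_compose[simplified])

lemma bi_compose_varz_left [simp]: "formal_map f \<Longrightarrow> bi_compose varz f = f"
  by (simp add: bi_compose_def ord_ge_1_compose[simplified])

lemma bi_compose_varz_right [simp]: "bi_compose f varz = f"
  by (simp add: bi_compose_def)

lemma bi_compose_mult: "formal_map f \<Longrightarrow> bi_compose (g * h) f = bi_compose g f * bi_compose h f"
  by (simp add: bi_compose_def bi_subst_mult ord_ge_1_compose[simplified])

lemma bi_compose_add: "bi_compose (g + h) f = bi_compose g f + bi_compose h f"
  by (simp add: bi_compose_def bi_subst_add)

lemma bi_compose_biconst_mult: "formal_map f \<Longrightarrow> bi_compose (biconst c * h) f = biconst c * bi_compose h f"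
  by (simp add: bi_compose_mult) (simp add: bi_compose_def bi_subst_biconst)

lemma poisson_bi_compose:
  assumes "formal_area_preserving f"
  shows "poisson (bi_compose g f) (bi_compose h f) = bi_compose (poisson g h) f"
  using assms unfolding bi_compose_def
  by (subst poisson_bi_subst)
    (simp_all add: formal_area_preserving_def ord_ge_1_compose[simplified] flip: formal_jacobian_eq_poisson)

lemma formal_area_preserving_bi_compose:
  assumes "formal_area_preserving f" "formal_area_preserving g"
  shows "formal_area_preserving (bi_compose f g)"
  using assms poisson_bi_compose[OF assms(2), of f "conj_bifps f"]
  by (simp add: formal_area_preserving_def formal_map_bi_compose formal_jacobian_eq_poisson conj_bi_compose)
    (simp add: bi_compose_def)

lemma real_valued_bi_compose: "formal_map f \<Longrightarrow> real_valued h \<Longrightarrow> real_valued (bi_compose h f)"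
  by (simp add: real_valued_def conj_bi_compose)

section \<open>Rotations and resonant series\<close>

lemma bicoeff_bi_compose_scale:
  "bicoeff (bi_compose h (biconst c * varz)) k l = c ^ k * cnj c ^ l * bicoeff h k l"
proof -
  let ?S = "\<lambda>h. Abs_bifps (\<lambda>k l. c ^ k * cnj c ^ l * bicoeff h k l)"
  let ?u = "biconst c * varz"
  have u: "ord_ge 1 ?u" "ord_ge 1 (conj_bifps ?u)"
    by (simp_all add: bisupp_biconst_mult ord_ge_varz[simplified] ord_ge_conj)
  have "bi_subst h ?u (conj_bifps ?u) = ?S h"
  proof (rule bifps_operator_eqI[where d = 0 and f = h])
    show "bi_subst (bimonom a i j) ?u (conj_bifps ?u) = ?S (bimonom a i j)" for a i j
    proof -
      have const_power: "biconst a ^ i = biconst (a ^ i)" for a i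
        by (induction i) (simp_all add: biconst_mult)
      have "bi_subst (bimonom a i j) ?u (conj_bifps ?u) = biconst (c ^ i * cnj c ^ j) * bimonom a i j"
        unfolding bi_subst_bimonom[OF u]
        by (simp add: bimonom_eq conj_mult conj_biconst power_mult_distrib const_power biconst_mult mult_ac)
      then show ?thesis
        by (intro bifps_eqI) (simp add: bicoeff_bimonom)
    qed
  qed (auto simp: Modules.additive_def bi_subst_add ord_ge_bi_subst algebra_simps
      intro!: bifps_eqI ord_geI dest: ord_geD)
  then show ?thesis
    by (simp add: bi_compose_def)
qed

text \<open>\<open>resonant n s\<close> collects the series with \<open>f \<circ> R = \<lambda>^s f\<close> for the rotation \<open>R\<close> by a
  primitive \<open>n\<close>-th root of unity \<open>\<lambda>\<close>.\<close>

definition resonant :: "nat \<Rightarrow> int \<Rightarrow> bifps \<Rightarrow> bool" where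
  "resonant n s = bisupp (\<lambda>k l. int n dvd int k - int l - s)"

lemma resonant_mult: "resonant n s f \<Longrightarrow> resonant n t g \<Longrightarrow> resonant n (s + t) (f * g)"
proof (unfold resonant_def, erule (1) bisupp_mult)
  fix a b c d assume "int n dvd int a - int b - s" "int n dvd int c - int d - t"
  from dvd_add[OF this] show "int n dvd int (a + c) - int (b + d) - (s + t)"
    by (simp add: algebra_simps)
qed

lemma resonant_1: "resonant n 0 1"
  by (simp add: resonant_def bisupp_def bicoeff_1)

lemma resonant_power: "resonant n s f \<Longrightarrow> resonant n (int k * s) (f ^ k)"
  by (induction k) (auto simp: resonant_1 distrib_right intro: resonant_mult)

lemma resonant_conj: "resonant n s f \<Longrightarrow> resonant n (- s) (conj_bifps f)"
  unfolding resonant_def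
  by (drule bisupp_conj, erule bisupp_mono) (metis (no_types, opaque_lifting) dvd_minus_iff minus_diff_eq
      diff_minus_eq_add add.commute diff_diff_eq2 uminus_add_conv_diff)

lemma resonant_bi_compose:
  assumes f: "resonant n s f" and u: "resonant n 1 u"
  shows "resonant n s (bi_compose f u)"
  unfolding resonant_def
proof (rule bisuppI)
  fix p q assume *: "\<not> int n dvd int p - int q - s"
  have "bicoeff f k l * bicoeff (u ^ k * conj_bifps u ^ l) p q = 0" for k l
  proof (rule ccontr)
    assume "\<not> ?thesis"
    moreover have "resonant n (int k * 1 + int l * - 1) (u ^ k * conj_bifps u ^ l)"
      by (intro resonant_mult resonant_power resonant_conj u)
    ultimately have "int n dvd int k - int l - s" "int n dvd int p - int q - (int k - int l)"
      using f by (auto simp: resonant_def bisupp_def)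
    from dvd_add[OF this] * show False
      by (simp add: algebra_simps)
  qed
  then show "bicoeff (bi_compose f u) p q = 0"
    unfolding bi_compose_def bi_subst_def bicoeff_Abs by (intro sum.neutral) auto
qed

lemma unit_power_mult_cnj_power:
  assumes "cmod c = 1"
  shows "c ^ k * cnj c ^ l = c powi (int k - int l)"
proof -
  have "c \<noteq> 0" using assms by auto
  moreover have "cnj c = inverse c"
    using complex_norm_square[of c] assms by (intro inverse_unique[symmetric]) simp
  ultimately show ?thesis
    by (simp add: power_int_diff power_inverse divide_inverse)
qed

lemma bi_compose_formal_rotation_commute:
  assumes D: "formal_map D" "resonant n 1 D" and \<alpha>: "cis \<alpha> ^ n = 1"
  shows "bi_compose D (formal_rotation \<alpha>) = bi_compose (formal_rotation \<alpha>) D"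
proof (rule bifps_eqI)
  fix k l
  have "cis \<alpha> powi (int k - int l) = cis \<alpha>" if "int n dvd int k - int l - 1"
  proof -
    from that obtain t where "int k - int l = int n * t + 1"
      by (metis add.commute diff_add_cancel dvd_def)
    then show ?thesis
      using \<alpha> by (simp add: power_int_add power_int_mult)
  qed
  then show "bicoeff (bi_compose D (formal_rotation \<alpha>)) k l = bicoeff (bi_compose (formal_rotation \<alpha>) D) k l"
    using D unfolding formal_rotation_def
    by (cases "bicoeff D k l = 0") (auto simp: bicoeff_bi_compose_scale bi_compose_biconst_mult
        resonant_def bisupp_def unit_power_mult_cnj_power)
qed

lemma takens_normal_form_resonant:
  assumes H: "bi_compose H (formal_rotation \<alpha>) = H"
    and n: "0 < n" "cis \<alpha> ^ n = 1" "\<And>m. 0 < m \<Longrightarrow> m < n \<Longrightarrow> cis \<alpha> ^ m \<noteq> 1"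
  shows "resonant n 0 H"
  unfolding resonant_def bisupp_def
proof (intro allI impI)
  fix k l assume "bicoeff H k l \<noteq> 0"
  moreover have "cis \<alpha> powi (int k - int l) * bicoeff H k l = bicoeff H k l"
    using arg_cong[OF H, of "\<lambda>h. bicoeff h k l"]
    by (simp add: formal_rotation_def bicoeff_bi_compose_scale unit_power_mult_cnj_power del: cis_cnj)
  ultimately have eq: "cis \<alpha> powi (int k - int l) = 1" by simp
  \<comment> \<open>Minimality of \<open>n\<close> speaks only about exponents strictly between 0
    and \<open>n\<close>, so the integer exponent is reduced first.\<close>
  define m where "m = (int k - int l) mod int n"
  have m: "0 \<le> m" "m < int n" using n(1) by (auto simp: m_def)
  have "cis \<alpha> powi (int n * ((int k - int l) div int n) + m) = 1"
    using eq by (simp add: m_def)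
  then have "cis \<alpha> powi m = 1"
    using n(2) by (simp add: power_int_add power_int_mult)
  then have "cis \<alpha> ^ nat m = 1"
    using m by (simp add: power_int_def)
  then have "m = 0"
    using n(3)[of "nat m"] m by force
  then show "int n dvd int k - int l - 0"
    by (simp add: m_def dvd_eq_mod_eq_0)
qed

section \<open>Coefficientwise time derivatives and conjugation of flows\<close>

definition bifps_has_deriv :: "(real \<Rightarrow> bifps) \<Rightarrow> bifps \<Rightarrow> real \<Rightarrow> bool" where
  "bifps_has_deriv U U' t \<longleftrightarrow>
     (\<forall>p q. ((\<lambda>s. bicoeff (U s) p q) has_vector_derivative bicoeff U' p q) (at t))"

lemma bifps_has_deriv_const: "bifps_has_deriv (\<lambda>_. f) 0 t"
  by (simp add: bifps_has_deriv_def)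

lemma bifps_has_deriv_mult:
  assumes "bifps_has_deriv U U' t" "bifps_has_deriv V V' t"
  shows "bifps_has_deriv (\<lambda>s. U s * V s) (U' * V t + U t * V') t"
  unfolding bifps_has_deriv_def
proof (intro allI)
  fix p q
  have "((\<lambda>s. \<Sum>i\<le>p. \<Sum>j\<le>q. bicoeff (U s) i j * bicoeff (V s) (p - i) (q - j)) has_vector_derivative
      (\<Sum>i\<le>p. \<Sum>j\<le>q. bicoeff (U t) i j * bicoeff V' (p - i) (q - j)
        + bicoeff U' i j * bicoeff (V t) (p - i) (q - j))) (at t)"
    using assms unfolding bifps_has_deriv_def
    by (intro has_vector_derivative_sum has_vector_derivative_mult) auto
  then show "((\<lambda>s. bicoeff (U s * V s) p q) has_vector_derivative bicoeff (U' * V t + U t * V') p q) (at t)"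
    by (simp add: bicoeff_mult sum.distrib add.commute)
qed

lemma bifps_has_deriv_power:
  assumes "bifps_has_deriv U U' t"
  shows "bifps_has_deriv (\<lambda>s. U s ^ k) (of_nat k * U t ^ (k - 1) * U') t"
proof (induction k)
  case 0
  then show ?case by (simp add: bifps_has_deriv_const)
next
  case (Suc k)
  from bifps_has_deriv_mult[OF assms this] show ?case
    by (cases k) (simp_all add: algebra_simps)
qed

lemma bifps_has_deriv_sum:
  assumes "\<And>x. x \<in> S \<Longrightarrow> bifps_has_deriv (U x) (U' x) t"
  shows "bifps_has_deriv (\<lambda>s. \<Sum>x\<in>S. U x s) (\<Sum>x\<in>S. U' x) t"
  using assms by (simp add: bifps_has_deriv_def has_vector_derivative_sum)

lemma bifps_has_deriv_conj:
  assumes "bifps_has_deriv U U' t"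
  shows "bifps_has_deriv (\<lambda>s. conj_bifps (U s)) (conj_bifps U') t"
  using assms by (simp add: bifps_has_deriv_def bounded_linear.has_vector_derivative[OF bounded_linear_cnj])

lemma bifps_has_deriv_bi_subst_const:
  assumes "bifps_has_deriv U U' t"
  shows "bifps_has_deriv (\<lambda>s. bi_subst (U s) u v) (bi_subst U' u v) t"
  using assms unfolding bifps_has_deriv_def bi_subst_def bicoeff_Abs case_prod_unfold
  by (intro allI has_vector_derivative_sum has_vector_derivative_mult_left) auto

lemma bifps_has_deriv_bi_subst:
  assumes U: "bifps_has_deriv U U' t" "\<And>s. ord_ge 1 (U s)"
    and V: "bifps_has_deriv V V' t" "\<And>s. ord_ge 1 (V s)"
  shows "bifps_has_deriv (\<lambda>s. bi_subst h (U s) (V s))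
     (bi_subst (deriv_z h) (U t) (V t) * U' + bi_subst (deriv_zbar h) (U t) (V t) * V') t"
    (is "bifps_has_deriv _ (?R h) t")
  unfolding bifps_has_deriv_def
proof (intro allI)
  fix p q
  have nat: "of_nat k = biconst (of_nat k)" for k
    by (simp add: biconst_def fps_of_nat)
  have additive_R: "Modules.additive ?R"
    by (simp add: Modules.additive_def deriv_z_add deriv_zbar_add bi_subst_add algebra_simps)
  have bimonom: "bifps_has_deriv (\<lambda>s. bi_subst (bimonom c k l) (U s) (V s)) (?R (bimonom c k l)) t" for c k l
  proof -
    have eq: "?R (bimonom c k l) = 0 * (U t ^ k * V t ^ l) + biconst c *
       (of_nat k * U t ^ (k - 1) * U' * V t ^ l + U t ^ k * (of_nat l * V t ^ (l - 1) * V'))"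
      by (simp only: bi_subst_bimonom[OF U(2) V(2)] deriv_z_bimonom deriv_zbar_bimonom biconst_mult flip: nat)
        (simp add: algebra_simps)
    show ?thesis
      unfolding eq bi_subst_bimonom[OF U(2) V(2)]
      by (intro bifps_has_deriv_mult bifps_has_deriv_const bifps_has_deriv_power U V)
  qed
  \<comment> \<open>Only finitely many monomials of \<open>h\<close> influence the coefficient; the
    extra degree compensates for the one lost in \<open>deriv_z\<close> and
    \<open>deriv_zbar\<close>.\<close>
  let ?g = "bitrunc (Suc (p + q)) h"
  have g: "ord_ge (Suc (Suc (p + q))) (h - ?g)"
    by (rule ord_ge_diff_bitrunc)
  have L: "bicoeff (bi_subst h (U s) (V s)) p q = bicoeff (bi_subst ?g (U s) (V s)) p q" for s
    using ord_geD[OF ord_ge_bi_subst[OF g], of p q "U s" "V s"] by (simp add: bi_subst_diff)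
  have "ord_ge (Suc (p + q) + 0) (bi_subst (deriv_z (h - ?g)) (U t) (V t) * U')"
    "ord_ge (Suc (p + q) + 0) (bi_subst (deriv_zbar (h - ?g)) (U t) (V t) * V')"
    using ord_ge_deriv_z[OF g] ord_ge_deriv_zbar[OF g]
    by (intro ord_ge_mult ord_ge_bi_subst ord_ge_0; simp)+
  then have R: "bicoeff (?R (h - ?g)) p q = 0"
    by (simp add: ord_geD)
  have "bifps_has_deriv (\<lambda>s. \<Sum>(k, l)\<in>{(k, l). k + l \<le> Suc (p + q)}. bi_subst (bimonom (bicoeff h k l) k l) (U s) (V s))
      (\<Sum>(k, l)\<in>{(k, l). k + l \<le> Suc (p + q)}. ?R (bimonom (bicoeff h k l) k l)) t"
    unfolding case_prod_unfold by (intro bifps_has_deriv_sum bimonom)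
  then have "bifps_has_deriv (\<lambda>s. bi_subst ?g (U s) (V s)) (?R ?g) t"
    unfolding bitrunc_def Modules.additive.sum[OF additive_bi_subst] Modules.additive.sum[OF additive_R]
    by (simp add: case_prod_unfold)
  then have "((\<lambda>s. bicoeff (bi_subst h (U s) (V s)) p q) has_vector_derivative bicoeff (?R ?g) p q) (at t)"
    by (simp add: bifps_has_deriv_def L)
  also have "bicoeff (?R ?g) p q = bicoeff (?R h) p q"
    using R unfolding Modules.additive.diff[OF additive_R] by simp
  finally show "((\<lambda>s. bicoeff (bi_subst h (U s) (V s)) p q) has_vector_derivative bicoeff (?R h) p q) (at t)" .
qed

text \<open>Along the flow \<open>C\<close> has time derivative -i times its bracket with
  \<open>H\<close>. Since \<open>H\<close> is \<open>K\<close> composed with the area-preserving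
  \<open>C\<close>, this bracket is that of \<open>z\<close> with \<open>K\<close>, composed with
  \<open>C\<close>, which is the vector field of \<open>K\<close> at the image point.\<close>

lemma formal_flow_conjugate:
  assumes \<Phi>: "formal_flow H \<Phi>" and H: "real_valued H"
    and C: "formal_area_preserving C" and D: "formal_map D"
    and CD: "bi_compose C D = varz" and DC: "bi_compose D C = varz"
  shows "formal_flow (bi_compose H D) (\<lambda>t. bi_compose (bi_compose C (\<Phi> t)) D)"
proof -
  define K where "K = bi_compose H D"
  have C': "formal_map C" and \<Phi>': "formal_map (\<Phi> t)" for t
    using C \<Phi> by (auto simp: formal_area_preserving_def formal_flow_def)
  have H_eq: "H = bi_compose K C"
    by (simp add: K_def bi_compose_assoc C' D DC)
  have "poisson C H = poisson (bi_compose varz C) (bi_compose K C)"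
    by (simp add: C' H_eq)
  also have "\<dots> = bi_compose (deriv_zbar K) C"
  proof -
    have "deriv_z varz = 1" "deriv_zbar varz = 0"
      by (rule bifps_eqI, simp add: varz_eq_bimonom bicoeff_bimonom bicoeff_1)+
    then show ?thesis
      unfolding poisson_bi_compose[OF C] by (simp add: poisson_def)
  qed
  finally have poisson_C: "poisson C H = bi_compose (deriv_zbar K) C" .
  have "bifps_has_deriv (\<lambda>t. bi_compose (bi_compose C (\<Phi> t)) D)
      (bi_compose (biconst (- \<i>) * deriv_zbar K) (bi_compose (bi_compose C (\<Phi> t)) D)) t" for t
  proof -
    let ?G = "biconst (- \<i>) * deriv_zbar H"
    have d: "bifps_has_deriv \<Phi> (bi_compose ?G (\<Phi> t)) t"
      using \<Phi> by (simp add: formal_flow_def bifps_has_deriv_def)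
    have "conj_bifps ?G = biconst \<i> * deriv_z H"
      using H by (simp add: conj_mult conj_biconst conj_deriv_zbar real_valued_def)
    then have d': "bifps_has_deriv (\<lambda>s. conj_bifps (\<Phi> s)) (bi_compose (biconst \<i> * deriv_z H) (\<Phi> t)) t"
      using bifps_has_deriv_conj[OF d] conj_bi_compose[OF \<Phi>', of ?G t] by simp
    have "bifps_has_deriv (\<lambda>s. bi_compose C (\<Phi> s))
        (bi_compose (deriv_z C) (\<Phi> t) * bi_compose ?G (\<Phi> t) +
         bi_compose (deriv_zbar C) (\<Phi> t) * bi_compose (biconst \<i> * deriv_z H) (\<Phi> t)) t"
      using bifps_has_deriv_bi_subst[OF d _ d', of C] ord_ge_1_compose[OF \<Phi>']
      by (simp add: bi_compose_def)
    also have "bi_compose (deriv_z C) (\<Phi> t) * bi_compose ?G (\<Phi> t) +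
         bi_compose (deriv_zbar C) (\<Phi> t) * bi_compose (biconst \<i> * deriv_z H) (\<Phi> t) =
       bi_compose (deriv_z C * ?G + deriv_zbar C * (biconst \<i> * deriv_z H)) (\<Phi> t)"
      by (simp add: bi_compose_add bi_compose_mult \<Phi>')
    also have "deriv_z C * ?G + deriv_zbar C * (biconst \<i> * deriv_z H) = biconst (- \<i>) * poisson C H"
    proof -
      have "biconst (- \<i>) = - biconst \<i>"
        by (rule bifps_eqI) (simp add: bicoeff_biconst)
      then show ?thesis by (simp add: poisson_def algebra_simps)
    qed
    finally have "bifps_has_deriv (\<lambda>s. bi_compose C (\<Phi> s)) (bi_compose (biconst (- \<i>) * poisson C H) (\<Phi> t)) t" .
    then have "bifps_has_deriv (\<lambda>t. bi_compose (bi_compose C (\<Phi> t)) D)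
      (bi_compose (bi_compose (biconst (- \<i>) * poisson C H) (\<Phi> t)) D) t"
      unfolding bi_compose_def[of _ D] by (rule bifps_has_deriv_bi_subst_const)
    then show ?thesis
      by (simp add: poisson_C bi_compose_assoc C' D \<Phi>' formal_map_bi_compose flip: bi_compose_biconst_mult[OF C'])
  qed
  then show ?thesis
    using \<Phi> by (auto simp: formal_flow_def CD C' D K_def formal_map_bi_compose bifps_has_deriv_def)
qed

text \<open>\<open>C\<close> sends old to new variables, so the Hamiltonian is composed with its
  inverse \<open>D\<close>. Resonance of class 1 makes the maps commute with the rotation; carrying
  the explicit inverse makes the relation easy to compose.\<close>

definition takens_equiv :: "nat \<Rightarrow> bifps \<Rightarrow> bifps \<Rightarrow> bool" where
  "takens_equiv n H K \<longleftrightarrow>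
     (\<exists>C D. formal_area_preserving C \<and> formal_area_preserving D \<and> resonant n 1 C \<and> resonant n 1 D \<and>
        bi_compose C D = varz \<and> bi_compose D C = varz \<and> K = bi_compose H D)"

lemma takens_equiv_trans:
  assumes "takens_equiv n H K" "takens_equiv n K L"
  shows "takens_equiv n H L"
proof -
  from assms obtain C D C' D' where
    *: "formal_area_preserving C" "formal_area_preserving D" "resonant n 1 C" "resonant n 1 D"
      "bi_compose C D = varz" "bi_compose D C = varz" "K = bi_compose H D"
      "formal_area_preserving C'" "formal_area_preserving D'" "resonant n 1 C'" "resonant n 1 D'"
      "bi_compose C' D' = varz" "bi_compose D' C' = varz" "L = bi_compose K D'"
    unfolding takens_equiv_def by blast
  then have maps: "formal_map C" "formal_map D" "formal_map C'" "formal_map D'"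
    by (simp_all add: formal_area_preserving_def)
  have "bi_compose (bi_compose C' C) (bi_compose D D') = bi_compose C' (bi_compose (bi_compose C D) D')"
    "bi_compose (bi_compose D D') (bi_compose C' C) = bi_compose D (bi_compose (bi_compose D' C') C)"
    by (simp_all add: maps bi_compose_assoc formal_map_bi_compose)
  with * maps show ?thesis
    unfolding takens_equiv_def
    by (intro exI[of _ "bi_compose C' C"] exI[of _ "bi_compose D D'"])
      (simp add: formal_area_preserving_bi_compose resonant_bi_compose bi_compose_assoc)
qed

lemma takens_equiv_scale:
  assumes "cmod c = 1"
  shows "takens_equiv n H (bi_compose H (biconst c * varz))"
proof -
  have c: "cnj c * c = 1" "c * cnj c = 1"
    using complex_norm_square[of c] assms by (simp_all add: mult.commute[of "cnj c"])
  have *: "formal_area_preserving (biconst a * varz)" if "a * cnj a = 1" for a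
  proof -
    have "formal_map (biconst a * varz)"
      using formal_map_varz by (simp add: formal_map_def)
    moreover have "poisson (biconst a * varz) (biconst (cnj a) * varzbar) = biconst (a * cnj a)"
      by (simp add: poisson_biconst_mult_left poisson_biconst_mult_right poisson_varz_varzbar biconst_mult)
    ultimately show ?thesis
      using that by (simp add: formal_area_preserving_def formal_jacobian_eq_poisson conj_mult conj_biconst)
  qed
  have **: "bi_compose (biconst a * varz) (biconst b * varz) = varz" if "a * b = 1" for a b
    using that by (intro bifps_eqI) (simp only: bicoeff_bi_compose_scale bicoeff_biconst_mult,
        simp add: varz_eq_bimonom bicoeff_bimonom mult.commute)
  have "resonant n 1 (biconst a * varz)" for a
    by (simp add: resonant_def bisupp_biconst_mult bisupp_bimonom varz_eq_bimonom)
  then show ?thesis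
    unfolding takens_equiv_def
    using *[of c] *[of "cnj c"] **[of c "cnj c"] **[of "cnj c" c] c
    by (intro exI[of _ "biconst (cnj c) * varz"] exI[of _ "biconst c * varz"]) simp
qed

lemma resonant_ham_deriv:
  assumes "resonant n 0 \<eta>" "resonant n s f"
  shows "resonant n s (ham_deriv \<eta> f)"
  unfolding resonant_def
proof (rule bisupp_ham_deriv[OF assms(2,1)[unfolded resonant_def]])
  fix a b c d k l assume *: "int n dvd int a - int b - s" "int n dvd int c - int d - 0"
    "a + c = Suc k" "b + d = Suc l"
  then have "int k - int l - s = (int a - int b - s) + (int c - int d - 0)"
    by linarith
  then show "int n dvd int k - int l - s"
    using dvd_add[OF *(1,2)] by (simp only:)
qed

lemma resonant_lie_exp: "resonant n 0 \<eta> \<Longrightarrow> resonant n s f \<Longrightarrow> resonant n s (lie_exp \<eta> f)"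
  using resonant_ham_deriv[of n \<eta> s] unfolding resonant_def
  by (intro bisupp_lie_exp bisupp_lie_term[where P = "\<lambda>_ k l. int n dvd int k - int l - s"]) auto

lemma takens_equiv_lie_exp:
  assumes "ord_ge 3 \<eta>" "real_valued \<eta>" "resonant n 0 \<eta>"
  shows "takens_equiv n H (lie_exp \<eta> H)"
proof -
  have uminus: "ord_ge 3 (- \<eta>)" "real_valued (- \<eta>)" "resonant n 0 (- \<eta>)"
    using assms bisupp_diff[OF bisupp_0, of _ \<eta>] conj_diff[of 0 \<eta>] conj_diff[of 0 0]
    by (simp_all add: resonant_def real_valued_def)
  have "resonant n 1 varz"
    by (simp add: resonant_def varz_eq_bimonom bisupp_bimonom)
  then show ?thesis
    unfolding takens_equiv_def
    using assms uminus lie_exp_uminus_lie_exp[OF assms(1), of varz] lie_exp_uminus_lie_exp[OF uminus(1), of varz]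
    by (intro exI[of _ "lie_exp (- \<eta>) varz"] exI[of _ "lie_exp \<eta> varz"])
      (simp add: formal_area_preserving_lie_exp resonant_lie_exp flip: lie_exp_eq_bi_compose)
qed

text \<open>\<open>C\<close> can be moved past the rotation because it is resonant; what remains is
  the conjugated flow at time one.\<close>

lemma rotated_time_one_map_takens_equiv:
  assumes "takens_equiv n H K" and \<alpha>: "cis \<alpha> ^ n = 1" and H: "real_valued H"
    and N: "rotated_time_one_map \<alpha> H N"
  shows "real_valued K \<and> (\<exists>C M. formal_canonical_change C \<and> bi_compose C N = bi_compose M C \<and>
    rotated_time_one_map \<alpha> K M)"
proof -
  from assms(1) obtain C D where
    CD: "formal_area_preserving C" "formal_area_preserving D" "resonant n 1 C" "resonant n 1 D"
      "bi_compose C D = varz" "bi_compose D C = varz" "K = bi_compose H D"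
    unfolding takens_equiv_def by blast
  then have maps: "formal_map C" "formal_map D" by (simp_all add: formal_area_preserving_def)
  from N obtain \<Phi> where \<Phi>: "formal_flow H \<Phi>" "N = bi_compose (formal_rotation \<alpha>) (\<Phi> 1)"
    unfolding rotated_time_one_map_def by blast
  have maps': "formal_map (\<Phi> 1)" "formal_map (formal_rotation \<alpha>)"
    using \<Phi>(1) by (simp_all add: formal_flow_def)
      (simp add: formal_map_def formal_rotation_def varz_eq_bimonom bicoeff_bimonom)
  let ?\<Psi> = "\<lambda>t. bi_compose (bi_compose C (\<Phi> t)) D"
  let ?M = "bi_compose (formal_rotation \<alpha>) (?\<Psi> 1)"
  have "formal_flow K ?\<Psi>"
    unfolding CD(7) using formal_flow_conjugate[OF \<Phi>(1) H CD(1) maps(2) CD(5,6)] .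
  then have "rotated_time_one_map \<alpha> K ?M"
    unfolding rotated_time_one_map_def by blast
  moreover have "bi_compose C N = bi_compose ?M C"
  proof -
    have "bi_compose ?M C = bi_compose (bi_compose (formal_rotation \<alpha>) C) (\<Phi> 1)"
      by (simp add: bi_compose_assoc maps maps' formal_map_bi_compose CD)
    also have "\<dots> = bi_compose (bi_compose C (formal_rotation \<alpha>)) (\<Phi> 1)"
      by (simp add: bi_compose_formal_rotation_commute[OF maps(1) CD(3) \<alpha>])
    also have "\<dots> = bi_compose C N"
      by (simp add: \<Phi>(2) bi_compose_assoc maps maps')
    finally show ?thesis ..
  qed
  moreover have "formal_canonical_change C"
    unfolding formal_canonical_change_def formal_invertible_def using CD maps by blast
  ultimately show ?thesis
    using real_valued_bi_compose[OF maps(2) H] CD(7) by blast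
qed

section \<open>The weight filtration\<close>

text \<open>A resonant monomial \<open>z^(j n + l) zbar^l\<close> has weight \<open>n (j + l)\<close>: with \<open>w = z^n\<close> and
  \<open>I = z zbar\<close>, this is \<open>n\<close> times its degree as a monomial in \<open>I\<close> and \<open>w\<close>.\<close>

definition wt :: "nat \<Rightarrow> nat \<Rightarrow> nat \<Rightarrow> nat" where
  "wt n k l = min (k + (n - 1) * l) ((n - 1) * k + l)"

abbreviation wt_ge :: "nat \<Rightarrow> nat \<Rightarrow> bifps \<Rightarrow> bool" where
  "wt_ge n m \<equiv> bisupp (\<lambda>k l. m \<le> wt n k l)"

lemma wt_geD: "wt_ge n m f \<Longrightarrow> wt n k l < m \<Longrightarrow> bicoeff f k l = 0"
  using bisuppD by fastforce

lemma wt_geI: "(\<And>k l. wt n k l < m \<Longrightarrow> bicoeff f k l = 0) \<Longrightarrow> wt_ge n m f"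
  by (metis (no_types, lifting) bisuppI linorder_not_le)

lemma wt_ge_mono: "wt_ge n a f \<Longrightarrow> b \<le> a \<Longrightarrow> wt_ge n b f"
  by (erule bisupp_mono) auto

lemma wt_commute: "wt n k l = wt n l k"
  by (simp add: wt_def min.commute add.commute)

text \<open>A minimum of two linear forms. The inequality is strict when the factors attain their
  minima only in different forms, as \<open>z^n\<close> and \<open>zbar^n\<close> do.\<close>

lemma wt_superadditive: "wt n a b + wt n c d \<le> wt n (a + c) (b + d)"
proof -
  have "min x y + min x' y' \<le> min (x + x') (y + y')" for x y x' y' :: nat
    by linarith
  from this[of "a + (n - 1) * b" "(n - 1) * a + b" "c + (n - 1) * d" "(n - 1) * c + d"]
  show ?thesis
    unfolding wt_def distrib_left by (simp add: add_ac)
qed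

lemma wt_Suc_Suc: "0 < n \<Longrightarrow> wt n (Suc k) (Suc l) = wt n k l + n"
  by (cases n) (auto simp: wt_def)

lemma wt_resonant:
  assumes "2 \<le> n"
  shows "wt n (j * n + l) l = n * (j + l)"
proof -
  from assms obtain r where n: "n = r + 2" by (metis add.commute le_Suc_ex)
  show ?thesis
    unfolding wt_def n by (simp add: min_def algebra_simps)
qed

text \<open>A bracket multiplies two monomials and removes one factor \<open>z zbar\<close>, whose
  weight is exactly \<open>n\<close>.\<close>

lemma wt_ge_ham_deriv:
  assumes "0 < n" "wt_ge n m \<eta>" "wt_ge n m' f"
  shows "wt_ge n (m + m' - n) (ham_deriv \<eta> f)"
proof (rule bisupp_ham_deriv[OF assms(3,2)])
  fix a b c d k l assume *: "m' \<le> wt n a b" "m \<le> wt n c d" "a + c = Suc k" "b + d = Suc l"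
  have "wt n a b + wt n c d \<le> wt n k l + n"
    using wt_superadditive[of n a b c d] * by (simp add: wt_Suc_Suc assms(1))
  then show "m + m' - n \<le> wt n k l"
    using * by simp
qed

text \<open>The two linear forms average to n (k + l) / 2, so the weight bounds the degree from
  below. Hence generators of weight at least 2 n have convergent Lie series.\<close>

lemma ord_ge_3_of_wt:
  assumes "3 \<le> n" "wt_ge n (2 * n) f"
  shows "ord_ge 3 f"
proof (rule ord_geI)
  fix k l :: nat assume "k + l < 3"
  have "2 * wt n k l \<le> (k + (n - 1) * l) + ((n - 1) * k + l)"
  proof -
    have "2 * min x y \<le> x + y" for x y :: nat by linarith
    then show ?thesis unfolding wt_def .
  qed
  also have "\<dots> = n * (k + l)"
    using assms(1) by (cases n) (simp_all add: algebra_simps)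
  also have "\<dots> \<le> n * 2"
    using \<open>k + l < 3\<close> by (intro mult_le_mono2) simp
  finally have "wt n k l < 2 * n"
    using assms(1) by linarith
  then show "bicoeff f k l = 0"
    by (rule wt_geD[OF assms(2)])
qed

text \<open>Banach's fixed point theorem for the ultrametric of the weight, inside the closed set
  \<open>Q\<close>. Completeness is concrete: the coefficient at (k, l) no longer changes from
  iterate \<open>w k l + 1\<close> on.\<close>

lemma weighted_fixpoint:
  fixes w :: "nat \<Rightarrow> nat \<Rightarrow> nat"
  assumes Q: "Q f0" "\<And>f. Q f \<Longrightarrow> Q (F f)"
    and closed: "\<And>f. (\<And>M. \<exists>g. Q g \<and> bisupp (\<lambda>k l. M \<le> w k l) (f - g)) \<Longrightarrow> Q f"
    and contract: "\<And>f g M. Q f \<Longrightarrow> Q g \<Longrightarrow> bisupp (\<lambda>k l. M \<le> w k l) (f - g) \<Longrightarrow>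
      bisupp (\<lambda>k l. Suc M \<le> w k l) (F f - F g)"
  shows "\<exists>f. Q f \<and> F f = f"
proof -
  let ?agree = "\<lambda>M f g. bisupp (\<lambda>k l. M \<le> w k l) (f - g)"
  have agreeD: "bicoeff f k l = bicoeff g k l" if "?agree M f g" "w k l < M" for M f g k l
    using bisuppD[OF that(1), of k l] that(2) by simp
  define x where "x i = (F ^^ i) f0" for i
  have Qx: "Q (x i)" for i
    by (induction i) (simp_all add: x_def Q)
  have step: "?agree i (x i) (x (Suc i))" for i
  proof (induction i)
    case (Suc i)
    from contract[OF Qx Qx this] show ?case by (simp add: x_def)
  qed simp
  define y where "y = Abs_bifps (\<lambda>k l. bicoeff (x (Suc (w k l))) k l)"
  have stable: "bicoeff (x (Suc (w k l) + d)) k l = bicoeff (x (Suc (w k l))) k l" for k l d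
  proof (induction d)
    case (Suc d)
    then show ?case using agreeD[OF step[of "Suc (w k l) + d"], of k l] by simp
  qed simp
  have y: "?agree M y (x M)" for M
  proof (rule bisuppI)
    fix k l assume "\<not> M \<le> w k l"
    then show "bicoeff (y - x M) k l = 0"
      using stable[of k l "M - Suc (w k l)"] by (simp add: y_def)
  qed
  have Qy: "Q y"
    using closed y Qx by blast
  have "F y = y"
  proof (rule bifps_eqI)
    fix k l
    let ?M = "w k l"
    have "bicoeff (F y) k l = bicoeff (F (x ?M)) k l"
      using agreeD[OF contract[OF Qy Qx y]] by simp
    also have "F (x ?M) = x (Suc ?M)" by (simp add: x_def)
    also have "bicoeff (x (Suc ?M)) k l = bicoeff y k l"
      by (simp add: y_def)
    finally show "bicoeff (F y) k l = bicoeff y k l" .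
  qed
  with Qy show ?thesis by blast
qed

section \<open>The homological equation\<close>

text \<open>In polar coordinates this is \<open>a I^2 + 2 c I^n cos(2 n \<phi>)\<close>.\<close>

definition leading_part :: "nat \<Rightarrow> real \<Rightarrow> real \<Rightarrow> bifps" where
  "leading_part n a c = bimonom (of_real a) 2 2 + bimonom (of_real c) (2 * n) 0 + bimonom (of_real c) 0 (2 * n)"

lemma bicoeff_ham_deriv_bimonom:
  "bicoeff (ham_deriv \<eta> (bimonom b i j)) p q = - \<i> *
     ((if i - 1 \<le> p \<and> j \<le> q then of_nat i * b * (of_nat (Suc (q - j)) * bicoeff \<eta> (p - (i - 1)) (Suc (q - j))) else 0)
    - (if i \<le> p \<and> j - 1 \<le> q then of_nat j * b * (of_nat (Suc (p - i)) * bicoeff \<eta> (Suc (p - i)) (q - (j - 1))) else 0))"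
  by (simp add: ham_deriv_def poisson_def deriv_z_bimonom deriv_zbar_bimonom bicoeff_bimonom_mult
      del: of_nat_Suc)

lemma bicoeff_ham_deriv_leading_part:
  assumes "1 \<le> n"
  shows "bicoeff (ham_deriv \<eta> (leading_part n a c)) p q = - \<i> *
    ((if 1 \<le> p \<and> 1 \<le> q then 2 * of_real a * (of_nat q - of_nat p) * bicoeff \<eta> (p - 1) (q - 1) else 0)
   + (if 2 * n \<le> Suc p then 2 * of_nat n * of_real c * of_nat (Suc q) * bicoeff \<eta> (Suc p - 2 * n) (Suc q) else 0)
   - (if 2 * n \<le> Suc q then 2 * of_nat n * of_real c * of_nat (Suc p) * bicoeff \<eta> (Suc p) (Suc q - 2 * n) else 0))"
proof -
  have A: "bicoeff (ham_deriv \<eta> (bimonom (of_real a) 2 2)) p q = - \<i> *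
    (if 1 \<le> p \<and> 1 \<le> q then 2 * of_real a * (of_nat q - of_nat p) * bicoeff \<eta> (p - 1) (q - 1) else 0)"
  proof -
    \<comment> \<open>The guard 2 <= q can be relaxed to 1 <= q because the factor q - 1 vanishes at
      q = 1. Both terms then have the same guard, and their difference carries the factor q -
      p.\<close>
    have X: "(if 1 \<le> p \<and> 2 \<le> q then b * (of_nat (Suc (q - 2)) * bicoeff \<eta> (p - 1) (Suc (q - 2))) else 0) =
        (if 1 \<le> p \<and> 1 \<le> q then b * ((of_nat q - 1) * bicoeff \<eta> (p - 1) (q - 1)) else 0)" for b
    proof (cases q)
      case (Suc q')
      then show ?thesis by (cases q') simp_all
    qed simp
    have Y: "(if 2 \<le> p \<and> 1 \<le> q then b * (of_nat (Suc (p - 2)) * bicoeff \<eta> (Suc (p - 2)) (q - 1)) else 0) =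
        (if 1 \<le> p \<and> 1 \<le> q then b * ((of_nat p - 1) * bicoeff \<eta> (p - 1) (q - 1)) else 0)" for b
    proof (cases p)
      case (Suc p')
      then show ?thesis by (cases p') simp_all
    qed simp
    have "bicoeff (ham_deriv \<eta> (bimonom (of_real a) 2 2)) p q = - \<i> *
      ((if 1 \<le> p \<and> 2 \<le> q then 2 * of_real a * (of_nat (Suc (q - 2)) * bicoeff \<eta> (p - 1) (Suc (q - 2))) else 0)
      - (if 2 \<le> p \<and> 1 \<le> q then 2 * of_real a * (of_nat (Suc (p - 2)) * bicoeff \<eta> (Suc (p - 2)) (q - 1)) else 0))"
      by (simp add: bicoeff_ham_deriv_bimonom del: of_nat_Suc)
    also have "\<dots> = - \<i> *
        (if 1 \<le> p \<and> 1 \<le> q then 2 * of_real a * (of_nat q - of_nat p) * bicoeff \<eta> (p - 1) (q - 1) else 0)"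
      unfolding X Y by (auto simp: algebra_simps)
    finally show ?thesis .
  qed
  have B: "p - (2 * n - 1) = Suc p - 2 * n" "(2 * n - 1 \<le> p) = (2 * n \<le> Suc p)" for p
    using assms by auto
  have C: "bicoeff (ham_deriv \<eta> (bimonom (of_real c) (2 * n) 0)) p q = - \<i> *
      (if 2 * n \<le> Suc p then 2 * of_nat n * of_real c * of_nat (Suc q) * bicoeff \<eta> (Suc p - 2 * n) (Suc q) else 0)"
    unfolding bicoeff_ham_deriv_bimonom B by (simp del: of_nat_Suc)
  have D: "bicoeff (ham_deriv \<eta> (bimonom (of_real c) 0 (2 * n))) p q = - \<i> *
      - (if 2 * n \<le> Suc q then 2 * of_nat n * of_real c * of_nat (Suc p) * bicoeff \<eta> (Suc p) (Suc q - 2 * n) else 0)"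
    unfolding bicoeff_ham_deriv_bimonom B by (simp del: of_nat_Suc)
  have "- \<i> * x + - \<i> * y + - \<i> * - z = - \<i> * (x + y - z)" for x y z
    by (simp add: algebra_simps)
  then show ?thesis
    unfolding leading_part_def ham_deriv_add bicoeff_add A C D .
qed

text \<open>The part of \<open>ham_deriv \<eta> (leading_part n a c)\<close> that raises weights by exactly \<open>n\<close> on
  resonant series: products of a power of \<open>z^n\<close> with a power of \<open>zbar^n\<close> are dropped.\<close>

definition hom_op :: "nat \<Rightarrow> real \<Rightarrow> real \<Rightarrow> bifps \<Rightarrow> bifps" where
  "hom_op n a c \<eta> = Abs_bifps (\<lambda>p q. - \<i> *
    ((if 1 \<le> p \<and> 1 \<le> q then 2 * of_real a * (of_nat q - of_nat p) * bicoeff \<eta> (p - 1) (q - 1) else 0)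
   + (if q + 2 * n \<le> p then 2 * of_nat n * of_real c * of_nat (Suc q) * bicoeff \<eta> (Suc p - 2 * n) (Suc q) else 0)
   - (if p + 2 * n \<le> q then 2 * of_nat n * of_real c * of_nat (Suc p) * bicoeff \<eta> (Suc p) (Suc q - 2 * n) else 0)))"

lemma hom_op_diff: "hom_op n a c f - hom_op n a c g = hom_op n a c (f - g)"
  by (rule bifps_eqI) (simp add: hom_op_def algebra_simps)

text \<open>The source monomial contains more \<open>zbar\<close> than \<open>z\<close>.
  Multiplication by \<open>z^(2 n)\<close> thus creates a mixed product, and for n >= 3 the weight
  grows by more than \<open>n\<close>: these are the terms missing from
  \<open>hom_op\<close>.\<close>

lemma wt_cross:
  assumes "3 \<le> n" "2 * n \<le> Suc p" "p < q + 2 * n"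
  shows "wt n (Suc p - 2 * n) (Suc q) + n + 1 \<le> wt n p q"
proof -
  from assms(1) obtain r where n: "n = r + 3" by (metis add.commute le_Suc_ex)
  from assms(2) obtain s where s: "Suc p = s + 2 * n" by (metis add.commute le_Suc_ex)
  with assms(3) have "s \<le> q" by simp
  then obtain e where q: "q = s + e" by (metis le_Suc_ex)
  have p: "p = s + 2 * r + 5" using s n by simp
  show ?thesis
    unfolding wt_def n p q by (simp add: min_def algebra_simps)
qed

lemma wt_ge_hom_op_error:
  assumes "3 \<le> n" "wt_ge n m \<eta>"
  shows "wt_ge n (m + n + 1) (ham_deriv \<eta> (leading_part n a c) - hom_op n a c \<eta>)"
proof (rule wt_geI)
  fix p q assume wt: "wt n p q < m + n + 1"
  have "bicoeff \<eta> (Suc p - 2 * n) (Suc q) = 0" if "2 * n \<le> Suc p" "\<not> q + 2 * n \<le> p"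
    using wt_cross[of n p q] that assms wt by (intro wt_geD[OF assms(2)]) auto
  moreover have "bicoeff \<eta> (Suc p) (Suc q - 2 * n) = 0" if "2 * n \<le> Suc q" "\<not> p + 2 * n \<le> q"
    using wt_cross[of n q p] that assms wt
    by (intro wt_geD[OF assms(2)]) (auto simp: wt_commute[of n q] wt_commute[of n "Suc q - 2 * n"])
  ultimately show "bicoeff (ham_deriv \<eta> (leading_part n a c) - hom_op n a c \<eta>) p q = 0"
    using assms(1) by (auto simp: bicoeff_ham_deriv_leading_part hom_op_def)
qed

text \<open>
  On weight \<open>n m\<close> the homological equation splits into two chains of equations, one for each parity
  of \<open>j\<close>. The chain with \<open>j + m\<close> odd is solved upwards, using \<open>a \<noteq> 0\<close>, and the other one
  downwards, using \<open>c \<noteq> 0\<close>; the last equation of the latter is the obstruction.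
\<close>

function chain_up :: "complex \<Rightarrow> complex \<Rightarrow> nat \<Rightarrow> (nat \<Rightarrow> complex) \<Rightarrow> nat \<Rightarrow> complex" where
  "chain_up a c m g j = (if j = 0 then 0
     else ((if 2 \<le> j then c * of_nat (m + 1 - j) * chain_up a c m g (j - 2) else 0) - g j) / (a * of_nat j))"
  by pat_completeness auto
termination by (relation "Wellfounded.measure (\<lambda>(_, _, _, _, j). j)") auto

function chain_down :: "complex \<Rightarrow> complex \<Rightarrow> nat \<Rightarrow> (nat \<Rightarrow> complex) \<Rightarrow> nat \<Rightarrow> complex" where
  "chain_down a c m g j = (if m \<le> j then 0
     else (g (j + 2) + a * of_nat (j + 2) * chain_down a c m g (j + 2)) / (c * of_nat (m - 1 - j)))"
  by pat_completeness auto
termination by (relation "Wellfounded.measure (\<lambda>(_, _, m, _, j). m - j)") auto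

declare chain_up.simps [simp del] chain_down.simps [simp del]

text \<open>With \<open>x j\<close> the coefficient of \<open>I^(m-1-j) w^j\<close> in the
  generator, this is the coefficient of \<open>I^(m-j) w^j\<close> left after the homological step.
  The parameters will be 2 i n times the real \<open>a\<close> and \<open>c\<close>.\<close>

definition chain_residual :: "complex \<Rightarrow> complex \<Rightarrow> nat \<Rightarrow> (nat \<Rightarrow> complex) \<Rightarrow> (nat \<Rightarrow> complex) \<Rightarrow> nat \<Rightarrow> complex" where
  "chain_residual a c m g x j =
     g j + a * of_nat j * x j - (if 2 \<le> j then c * of_nat (m + 1 - j) * x (j - 2) else 0)"

text \<open>A generator of degree m - 1 has no entry from index m on. The entry at 0 belongs to the
  real monomial \<open>I^(m-1)\<close> and must be real: for odd m it is the free kernel direction,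
  set to 0 by \<open>chain_up\<close>; for even m only the real part of the wanted value can be
  used.\<close>

definition chain_solution :: "complex \<Rightarrow> complex \<Rightarrow> nat \<Rightarrow> (nat \<Rightarrow> complex) \<Rightarrow> nat \<Rightarrow> complex" where
  "chain_solution a c m g j =
     (if m \<le> j then 0 else if odd (j + m) then chain_up a c m g j
      else if j = 0 then of_real (Re (chain_down a c m g 0)) else chain_down a c m g j)"

lemma chain_solution_0_real: "chain_solution a c m g 0 \<in> \<real>"
  by (simp add: chain_solution_def chain_up.simps)

lemma chain_residual_chain_solution:
  assumes a: "a \<noteq> 0" and c: "c \<noteq> 0" and m: "3 \<le> m" and j: "1 \<le> j" "j \<le> m"
    and "\<not> (odd m \<and> j = 1)" "\<not> (even m \<and> j = 2)"
  shows "chain_residual a c m g (chain_solution a c m g) j = 0"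
proof (cases "odd (j + m)")
  case True
  then have "j \<noteq> m" "2 \<le> j \<Longrightarrow> odd (j - 2 + m)" by auto
  with True j m show ?thesis
    by (subst chain_residual_def, subst (1) chain_solution_def, subst chain_up.simps)
      (auto simp: chain_solution_def a)
next
  case False
  \<comment> \<open>The two excluded cases are exactly the obstructions; beyond them
    \<open>j - 2\<close> is positive, so taking real parts at index 0 does not interfere.\<close>
  then have j3: "j \<ge> 3" "even (j - 2 + m)"
    using assms(4,6,7) by (auto simp: numeral_3_eq_3 not_less_eq_eq[symmetric]) presburger+
  then have "chain_solution a c m g (j - 2) = chain_down a c m g (j - 2)"
    using j by (simp add: chain_solution_def)
  also have "\<dots> = (g j + a * of_nat j * chain_down a c m g j) / (c * of_nat (m + 1 - j))"
  proof -
    have "j - 2 + 2 = j" "m - 1 - (j - 2) = m + 1 - j" "\<not> m \<le> j - 2"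
      using j j3 m by auto
    then show ?thesis
      by (subst chain_down.simps) (simp only: if_False)
  qed
  finally have "c * of_nat (m + 1 - j) * chain_solution a c m g (j - 2) = g j + a * of_nat j * chain_down a c m g j"
    using c j by (simp del: of_nat_diff)
  moreover have "chain_solution a c m g j = chain_down a c m g j"
    using False j3 by (auto simp: chain_solution_def chain_down.simps)
  ultimately show ?thesis
    using j3 by (simp add: chain_residual_def)
qed

text \<open>What cannot be solved is \<open>c\<close> times the imaginary part of the wanted entry
  at 0, times i. As \<open>c\<close> is purely imaginary, this is real; hence no phase survives in
  the second harmonic.\<close>

lemma chain_residual_2:
  assumes c: "c \<noteq> 0" "Re c = 0" and m: "3 \<le> m" "even m"
  shows "chain_residual a c m g (chain_solution a c m g) 2 \<in> \<real>"
proof -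
  let ?y = "chain_down a c m g 0"
  have "?y = (g 2 + a * of_nat 2 * chain_down a c m g 2) / (c * of_nat (m - 1))"
    using m by (subst chain_down.simps) (simp add: numeral_2_eq_2)
  then have "c * of_nat (m - 1) * ?y = g 2 + a * of_nat 2 * chain_down a c m g 2"
    using c m by (simp add: of_nat_diff)
  moreover have "chain_solution a c m g 2 = chain_down a c m g 2"
    "chain_solution a c m g 0 = of_real (Re ?y)"
    using m by (auto simp: chain_solution_def)
  moreover have "m + 1 - 2 = m - 1" by simp
  ultimately have "chain_residual a c m g (chain_solution a c m g) 2 = c * of_nat (m - 1) * (?y - of_real (Re ?y))"
    by (simp add: chain_residual_def right_diff_distrib del: of_nat_diff)
  moreover have "Im (c * of_nat (m - 1) * (?y - of_real (Re ?y))) = 0"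
    using c by simp
  ultimately show ?thesis
    by (simp add: complex_is_Real_iff)
qed

lemma chain_up_cong: "j \<le> m \<Longrightarrow> (\<And>i. i \<le> m \<Longrightarrow> g i = g' i) \<Longrightarrow> chain_up a c m g j = chain_up a c m g' j"
  by (induction j rule: less_induct) (subst (1 2) chain_up.simps, auto)

lemma chain_down_cong:
  assumes "even (j + m)" "\<And>i. i \<le> m \<Longrightarrow> g i = g' i"
  shows "chain_down a c m g j = chain_down a c m g' j"
  using assms(1)
proof (induction "m - j" arbitrary: j rule: less_induct)
  case less
  show ?case
  proof (cases "m \<le> j")
    case False
    \<comment> \<open>Parity prevents the recursion from stepping over m and reading
      \<open>g (m + 1)\<close>.\<close>
    then have "j + 2 \<le> m" using less.prems by presburger
    then show ?thesis
      using less.hyps[of "j + 2"] less.prems assms(2)[of "j + 2"] by (subst (1 2) chain_down.simps) auto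
  qed (simp add: chain_down.simps)
qed

lemma chain_solution_cong:
  assumes "\<And>i. i \<le> m \<Longrightarrow> g i = g' i"
  shows "chain_solution a c m g j = chain_solution a c m g' j"
  using chain_up_cong[of j m g g'] assms chain_down_cong[OF _ assms, of j m]
  by (auto simp: chain_solution_def)

text \<open>The index m is one more than the degree j + l because the operator raises the degree by
  one. For m < 3 the entry is 0, which leaves the quadratic leading form alone and keeps the weight
  at least 2 n.\<close>

definition hom_solve_coeff :: "nat \<Rightarrow> real \<Rightarrow> real \<Rightarrow> bifps \<Rightarrow> nat \<Rightarrow> nat \<Rightarrow> complex" where
  "hom_solve_coeff n a c h j l = (let m = j + l + 1 in
     if m < 3 then 0 else
     chain_solution (2 * \<i> * of_nat n * of_real a) (2 * \<i> * of_nat n * of_real c) m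
       (\<lambda>j. bicoeff h (j * n + (m - j)) (m - j)) j)"

text \<open>Only exponents with k >= l are solved for; the others are filled by conjugation, so that
  the generator is real-valued.\<close>

definition hom_solve :: "nat \<Rightarrow> real \<Rightarrow> real \<Rightarrow> bifps \<Rightarrow> bifps" where
  "hom_solve n a c h = Abs_bifps (\<lambda>k l.
     if n dvd k - l \<and> l \<le> k then hom_solve_coeff n a c h ((k - l) div n) l
     else if n dvd l - k \<and> k \<le> l then cnj (hom_solve_coeff n a c h ((l - k) div n) k) else 0)"

lemma bicoeff_hom_solve:
  "0 < n \<Longrightarrow> bicoeff (hom_solve n a c h) (j * n + l) l = hom_solve_coeff n a c h j l"
  by (simp add: hom_solve_def)

lemma real_valued_hom_solve: "0 < n \<Longrightarrow> real_valued (hom_solve n a c h)"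
  unfolding real_valued_def
proof (rule bifps_eqI)
  fix k l
  have "cnj (hom_solve_coeff n a c h 0 l) = hom_solve_coeff n a c h 0 l" for l
    using chain_solution_0_real by (auto simp: hom_solve_coeff_def Let_def Reals_cnj_iff)
  then show "bicoeff (conj_bifps (hom_solve n a c h)) k l = bicoeff (hom_solve n a c h) k l"
    by (cases k l rule: linorder_cases) (auto simp: hom_solve_def)
qed

lemma bisupp_hom_solve:
  assumes "2 \<le> n"
  shows "bisupp (\<lambda>k l. int n dvd int k - int l \<and> 2 * n \<le> wt n k l) (hom_solve n a c h)"
proof (rule bisuppI)
  fix k l assume *: "\<not> (int n dvd int k - int l \<and> 2 * n \<le> wt n k l)"
  have coeff: "hom_solve_coeff n a c h ((k - l) div n) l = 0"
    if "n dvd k - l" "l \<le> k" "\<not> (int n dvd int k - int l \<and> 2 * n \<le> wt n k l)" for k l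
  proof -
    obtain j where k: "k = j * n + l"
      using \<open>n dvd k - l\<close> \<open>l \<le> k\<close> by (metis dvd_def le_add_diff_inverse2 mult.commute)
    then have "j + l + 1 < 3"
      using that(3) assms by (simp add: wt_resonant)
    then show ?thesis
      using k assms by (simp add: hom_solve_coeff_def Let_def)
  qed
  have "int n dvd int l - int k \<longleftrightarrow> int n dvd int k - int l"
    by (metis dvd_minus_iff minus_diff_eq)
  then show "bicoeff (hom_solve n a c h) k l = 0"
    using coeff[of k l] coeff[of l k] * by (auto simp: hom_solve_def wt_commute[of n l k])
qed

text \<open>The solution in one degree reads \<open>h\<close> only in the next degree, so solving
  loses exactly \<open>n\<close> in weight.\<close>

lemma wt_ge_hom_solve_diff:
  assumes n: "2 \<le> n" and h: "wt_ge n (M + n) (h - h')"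
  shows "wt_ge n M (hom_solve n a c h - hom_solve n a c h')"
proof (rule wt_geI)
  fix k l assume wt: "wt n k l < M"
  have coeff: "hom_solve_coeff n a c h ((k - l) div n) l = hom_solve_coeff n a c h' ((k - l) div n) l"
    if "n dvd k - l" "l \<le> k" "wt n k l < M" for k l
  proof -
    obtain j where k: "k = j * n + l"
      using \<open>n dvd k - l\<close> \<open>l \<le> k\<close> by (metis dvd_def le_add_diff_inverse2 mult.commute)
    then have M: "n * (j + l) < M"
      using that(3) n by (simp add: wt_resonant)
    have "bicoeff h (i * n + (j + l + 1 - i)) (j + l + 1 - i) = bicoeff h' (i * n + (j + l + 1 - i)) (j + l + 1 - i)"
      if "i \<le> j + l + 1" for i
    proof -
      have "wt n (i * n + (j + l + 1 - i)) (j + l + 1 - i) = n * (j + l) + n"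
        using that n wt_resonant[of n i "j + l + 1 - i"] by (simp add: algebra_simps)
      then show ?thesis
        using wt_geD[OF h, of "i * n + (j + l + 1 - i)" "j + l + 1 - i"] M by simp
    qed
    from chain_solution_cong[OF this] show ?thesis
      using k n by (simp add: hom_solve_coeff_def Let_def)
  qed
  show "bicoeff (hom_solve n a c h - hom_solve n a c h') k l = 0"
    using coeff[of k l] coeff[of l k] wt by (auto simp: hom_solve_def wt_commute[of n l k])
qed

text \<open>On \<open>I^q w^j\<close> the operator has two terms: \<open>a I^2\<close> contributes
  through the entry j of the generator, and \<open>c w^2\<close> through the entry j - 2.\<close>

lemma bicoeff_hom_op_hom_solve:
  assumes n: "0 < n" and m: "3 \<le> j + q" and j: "1 \<le> j"
  shows "bicoeff (h + hom_op n a c (hom_solve n a c h)) (j * n + q) q =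
    chain_residual (2 * \<i> * of_nat n * of_real a) (2 * \<i> * of_nat n * of_real c) (j + q)
      (\<lambda>i. bicoeff h (i * n + (j + q - i)) (j + q - i))
      (chain_solution (2 * \<i> * of_nat n * of_real a) (2 * \<i> * of_nat n * of_real c) (j + q)
        (\<lambda>i. bicoeff h (i * n + (j + q - i)) (j + q - i))) j"
    (is "_ = chain_residual ?a ?c _ ?g ?x j")
proof -
  have x: "bicoeff (hom_solve n a c h) (i * n + l) l = ?x i" if "i + l + 1 = j + q" for i l
    unfolding bicoeff_hom_solve[OF n] hom_solve_coeff_def Let_def that using m by (simp only: not_le[symmetric] if_False if_True not_True_eq_False)
  have A: "bicoeff (hom_solve n a c h) (j * n + q - 1) (q - 1) = ?x j" if "1 \<le> q"
  proof -
    have "j * n + (q - 1) = j * n + q - 1" "j + (q - 1) + 1 = j + q"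
      using that by simp_all
    with x[of j "q - 1"] show ?thesis by (simp only:)
  qed
  have B: "bicoeff (hom_solve n a c h) (Suc (j * n + q) - 2 * n) (Suc q) = ?x (j - 2)" if "2 \<le> j"
  proof -
    have "j * n = (j - 2) * n + 2 * n"
      using that by (simp only: add_mult_distrib[symmetric] le_add_diff_inverse2)
    then have eq: "Suc (j * n + q) - 2 * n = (j - 2) * n + Suc q"
      by linarith
    have "j - 2 + Suc q + 1 = j + q"
      using that by linarith
    then show ?thesis
      unfolding eq by (rule x)
  qed
  have C: "q + 2 * n \<le> j * n + q \<longleftrightarrow> 2 \<le> j"
    using n by simp
  \<comment> \<open>For \<open>q = 0\<close> the guard of the first term fails; this agrees with the
    default 0 of \<open>chain_solution\<close> at j = m.\<close>
  have D: "?x j = 0" if "q = 0"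
    using that by (simp add: chain_solution_def)
  have E: "\<not> j * n + q + 2 * n \<le> q"
    using n by simp
  have F: "1 \<le> j * n + q"
    using n j by (simp add: Suc_le_eq)
  have "bicoeff (hom_op n a c (hom_solve n a c h)) (j * n + q) q = - \<i> *
    ((if 1 \<le> q then 2 * of_real a * (of_nat q - of_nat (j * n + q)) * ?x j else 0)
     + (if 2 \<le> j then 2 * of_nat n * of_real c * of_nat (Suc q) * ?x (j - 2) else 0))"
    unfolding hom_op_def bicoeff_Abs using A B by (simp only: C E F if_False) simp
  also have "(if 1 \<le> q then 2 * of_real a * (of_nat q - of_nat (j * n + q)) * ?x j else 0) =
      - (2 * of_real a * of_nat j * of_nat n * ?x j)"
    using D by (cases "q = 0") simp_all
  finally have "bicoeff (hom_op n a c (hom_solve n a c h)) (j * n + q) q = - \<i> *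
    (- (2 * of_real a * of_nat j * of_nat n * ?x j)
     + (if 2 \<le> j then 2 * of_nat n * of_real c * of_nat (Suc q) * ?x (j - 2) else 0))" .
  moreover have "j + q + 1 - j = Suc q" "?g j = bicoeff h (j * n + q) q" by simp_all
  moreover have "- \<i> * (- (2 * of_real a * of_nat j * of_nat n * y)
       + (if 2 \<le> j then 2 * of_nat n * of_real c * of_nat (Suc q) * y' else 0)) =
     ?a * of_nat j * y - (if 2 \<le> j then ?c * of_nat (Suc q) * y' else 0)" for y y'
    by (cases "2 \<le> j") (simp_all add: algebra_simps)
  ultimately show ?thesis
    unfolding chain_residual_def bicoeff_add by (simp only: add_diff_eq)
qed

section \<open>Reduction to normal form\<close>

text \<open>The estimate behind the contraction. The k-fold brackets for \<open>f\<close> and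
  \<open>g\<close> differ in weight at least M + k n, which is negligible for k >= 2. For k = 1 the
  difference is linear in \<open>f - g\<close>, and up to higher weight it is the term that
  \<open>hom_op\<close> subtracts. The result gains n + 1, while solving loses only n.\<close>

lemma hom_op_wt_agree:
  assumes n: "3 \<le> n" and H: "wt_ge n (2 * n + 1) (H - leading_part n a c)"
    and f: "wt_ge n (2 * n) f" "wt_ge n (2 * n) g" and fg: "wt_ge n M (f - g)"
  shows "wt_ge n (M + n + 1) ((lie_exp f H - hom_op n a c f) - (lie_exp g H - hom_op n a c g))"
proof (rule wt_geI)
  fix p q assume wt: "wt n p q < M + n + 1"
  have n0: "0 < n" using n by simp
  note ord = ord_ge_3_of_wt[OF n f(1)] ord_ge_3_of_wt[OF n f(2)]
  have "wt_ge n (2 * n) (leading_part n a c)"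
    unfolding leading_part_def using n
    by (intro bisupp_add bisupp_bimonom) (auto simp: wt_def)
  from bisupp_add[OF this wt_ge_mono[OF H]] have H2: "wt_ge n (2 * n) H"
    by simp
  have g: "wt_ge n (2 * n + k * n) ((ham_deriv g ^^ k) H)" for k
  proof (induction k)
    case (Suc k)
    from wt_ge_ham_deriv[OF n0 f(2) this] show ?case
      by (simp add: algebra_simps)
  qed (simp add: H2)
  define d where "d k = (ham_deriv f ^^ k) H - (ham_deriv g ^^ k) H" for k
  have d: "wt_ge n (M + k * n) (d k)" if "0 < k" for k
    using that
  proof (induction k)
    case (Suc k)
    \<comment> \<open>Telescoping: one bracket with \<open>f\<close> is exchanged for one with
      \<open>g\<close> at a time.\<close>
    have "d (Suc k) = ham_deriv f (d k) + ham_deriv (f - g) ((ham_deriv g ^^ k) H)"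
      by (simp add: d_def ham_deriv_diff ham_deriv_diff_left)
    moreover have "wt_ge n (M + Suc k * n) (ham_deriv (f - g) ((ham_deriv g ^^ k) H))"
      using wt_ge_ham_deriv[OF n0 fg g[of k]] by (simp add: algebra_simps)
    moreover have "wt_ge n (M + Suc k * n) (ham_deriv f (d k))"
    proof (cases k)
      case 0
      then show ?thesis by (simp add: d_def)
    next
      case (Suc _)
      with Suc.IH have "wt_ge n (M + k * n) (d k)" by simp
      from wt_ge_ham_deriv[OF n0 f(1) this] show ?thesis by (simp add: algebra_simps)
    qed
    ultimately show ?case
      by (simp add: bisupp_add)
  qed simp
  have "bicoeff (d k) p q = 0" if "k \<noteq> 1" for k
  proof (cases "k = 0")
    case False
    then have "2 * n \<le> k * n" using that by (intro mult_le_mono1) simp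
    then have "wt n p q < M + k * n"
      using n wt by linarith
    then show ?thesis
      using False by (intro wt_geD[OF d]) simp_all
  qed (simp add: d_def)
  then have term_eq: "bicoeff (lie_term f k H) p q - bicoeff (lie_term g k H) p q =
      (if k = 1 then bicoeff (d 1) p q else 0)" for k
    by (auto simp: lie_term_def d_def)
  \<comment> \<open>The range ends at \<open>Suc (p + q)\<close> so that it contains the index 1
    even when p = q = 0.\<close>
  have "bicoeff (lie_exp f H - lie_exp g H) p q =
      (\<Sum>k\<le>Suc (p + q). bicoeff (lie_term f k H) p q) - (\<Sum>k\<le>Suc (p + q). bicoeff (lie_term g k H) p q)"
    unfolding bicoeff_diff by (intro arg_cong2[of _ _ _ _ "(-)"] bicoeff_lie_exp ord) simp_all
  also have "\<dots> = (\<Sum>k\<le>Suc (p + q). if k = 1 then bicoeff (d 1) p q else 0)"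
    unfolding sum_subtractf[symmetric] term_eq ..
  also have "\<dots> = bicoeff (d 1) p q"
    by (subst sum.delta) simp_all
  also have "d 1 = ham_deriv (f - g) (H - leading_part n a c) + ham_deriv (f - g) (leading_part n a c)"
    by (simp add: d_def ham_deriv_diff_left ham_deriv_diff)
  also have "bicoeff \<dots> p q = bicoeff (hom_op n a c (f - g)) p q"
  proof -
    have "M + (2 * n + 1) - n = M + n + 1" by simp
    with wt_ge_ham_deriv[OF n0 fg H] wt have "bicoeff (ham_deriv (f - g) (H - leading_part n a c)) p q = 0"
      by (intro wt_geD) (auto simp only:)
    moreover have "bicoeff (ham_deriv (f - g) (leading_part n a c) - hom_op n a c (f - g)) p q = 0"
      using wt_geD[OF wt_ge_hom_op_error[OF n fg] wt] .
    ultimately show ?thesis by simp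
  qed
  finally have "bicoeff (lie_exp f H - lie_exp g H) p q = bicoeff (hom_op n a c f - hom_op n a c g) p q"
    by (simp only: hom_op_diff)
  moreover have "bicoeff ((lie_exp f H - hom_op n a c f) - (lie_exp g H - hom_op n a c g)) p q =
      bicoeff (lie_exp f H - lie_exp g H) p q - bicoeff (hom_op n a c f - hom_op n a c g) p q"
    by simp
  ultimately show "bicoeff ((lie_exp f H - hom_op n a c f) - (lie_exp g H - hom_op n a c g)) p q = 0"
    by simp
qed

lemma wt_ge_lie_exp_diff:
  assumes n: "3 \<le> n" and H: "wt_ge n (2 * n) H" and f: "wt_ge n (2 * n) f"
  shows "wt_ge n (3 * n) (lie_exp f H - H)"
proof -
  have n0: "0 < n" using n by simp
  have "wt_ge n (2 * n + k * n) (lie_term f k H)" for k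
  proof (rule bisupp_lie_term[where P = "\<lambda>k a b. 2 * n + k * n \<le> wt n a b"])
    fix k h assume "wt_ge n (2 * n + k * n) h"
    from wt_ge_ham_deriv[OF n0 f this] show "wt_ge n (2 * n + Suc k * n) (ham_deriv f h)"
      by (simp add: algebra_simps)
  qed (simp add: H)
  then have zero: "bicoeff (lie_term f k H) p q = 0" if "k \<noteq> 0" "wt n p q < 3 * n" for k p q
  proof (rule wt_geD)
    have "1 * n \<le> k * n" using that(1) by (intro mult_le_mono1) simp
    then show "wt n p q < 2 * n + k * n" using that(2) by linarith
  qed
  show ?thesis
  proof (rule wt_geI)
    fix p q assume "wt n p q < 3 * n"
    with zero have "bicoeff (lie_term f k H) p q = (if k = 0 then bicoeff H p q else 0)" for k
      by simp
    then show "bicoeff (lie_exp f H - H) p q = 0"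
      by (simp add: lie_exp_def)
  qed
qed

text \<open>The target form in terms of the coefficient of \<open>I^l w^j\<close>: j = 1 gives
  \<open>b\<close> and its phase, and j = 2 with a real coefficient gives \<open>c\<close>.
  Conjugation determines the remaining coefficients.\<close>

definition reduced :: "nat \<Rightarrow> bifps \<Rightarrow> bool" where
  "reduced n K \<longleftrightarrow> (\<forall>l < 2. bicoeff K l l = 0) \<and>
     (\<forall>j l. 1 \<le> j \<longrightarrow> bicoeff K (j * n + l) l \<noteq> 0 \<longrightarrow>
        even l \<and> (j = 1 \<and> 2 \<le> l \<or> j = 2 \<and> bicoeff K (j * n + l) l \<in> \<real>))"

text \<open>For a fixed point \<open>f\<close> of \<open>hom_solve\<close> after \<open>R\<close>,
  the transformed Hamiltonian is \<open>R f\<close> plus \<open>hom_op\<close> of the solution for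
  \<open>R f\<close>. Its coefficients are therefore the residuals of the chains, and these vanish
  except at the obstructions.\<close>

lemma normalize_higher_order:
  assumes n: "3 \<le> n" and ac: "a \<noteq> 0" "c \<noteq> 0"
    and H: "wt_ge n (2 * n + 1) (H - leading_part n a c)"
  shows "\<exists>K. takens_equiv n H K \<and> reduced n K"
proof -
  have n0: "0 < n" "2 \<le> n" using n by simp_all
  define R where "R f = lie_exp f H - hom_op n a c f" for f
  let ?Q = "\<lambda>f. wt_ge n (2 * n) f \<and> resonant n 0 f \<and> real_valued f"
  have "\<exists>f. ?Q f \<and> hom_solve n a c (R f) = f"
  proof (rule weighted_fixpoint[where w = "wt n" and Q = ?Q and ?f0.0 = 0])
    show "?Q (hom_solve n a c (R f))" for f
      using bisupp_hom_solve[OF n0(2), of a c "R f"] real_valued_hom_solve[OF n0(1)]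
      by (auto simp: resonant_def elim!: bisupp_mono)
    show "?Q 0"
      by (simp add: resonant_def real_valued_def bifps_eqI)
  next
    fix f assume f: "\<And>M. \<exists>g. ?Q g \<and> wt_ge n M (f - g)"
    \<comment> \<open>Each condition in \<open>?Q\<close> concerns a coefficient and its mirror
      image, so agreement at these two places shows that \<open>?Q\<close> is closed.\<close>
    have near: "\<exists>g. ?Q g \<and> bicoeff f k l = bicoeff g k l \<and> bicoeff f l k = bicoeff g l k" for k l
    proof -
      obtain g where g: "?Q g" "wt_ge n (Suc (wt n k l)) (f - g)"
        using f by blast
      from wt_geD[OF g(2), of k l] wt_geD[OF g(2), of l k] g(1) show ?thesis
        by (intro exI[of _ g]) (simp add: wt_commute[of n l k])
    qed
    have "real_valued f"
      unfolding real_valued_def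
    proof (rule bifps_eqI)
      fix k l
      obtain g where "?Q g" "bicoeff f k l = bicoeff g k l" "bicoeff f l k = bicoeff g l k"
        using near by blast
      then show "bicoeff (conj_bifps f) k l = bicoeff f k l"
        by (metis bicoeff_conj real_valued_def)
    qed
    moreover have "wt_ge n (2 * n) f" "resonant n 0 f"
      unfolding resonant_def by (rule bisuppI; metis near bisuppD resonant_def)+
    ultimately show "?Q f" by blast
  next
    fix f g M assume "?Q f" "?Q g" "wt_ge n M (f - g)"
    then have "wt_ge n (Suc M + n) (R f - R g)"
      using hom_op_wt_agree[OF n H] by (simp add: R_def)
    then show "wt_ge n (Suc M) (hom_solve n a c (R f) - hom_solve n a c (R g))"
      by (rule wt_ge_hom_solve_diff[OF n0(2)])
  qed
  then obtain f where f: "?Q f" "hom_solve n a c (R f) = f" by blast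
  define K where "K = lie_exp f H"
  have "takens_equiv n H K"
    unfolding K_def using f(1) by (intro takens_equiv_lie_exp ord_ge_3_of_wt[OF n]) auto
  moreover have "reduced n K"
  proof -
    have leading: "wt_ge n (2 * n) (leading_part n a c)"
      unfolding leading_part_def using n
      by (intro bisupp_add bisupp_bimonom) (auto simp: wt_def)
    from bisupp_add[OF this wt_ge_mono[OF H]] have H2: "wt_ge n (2 * n) H"
      by simp
    have "wt_ge n (2 * n + 1) (K - H)"
      unfolding K_def using n f(1) H2 by (intro wt_ge_mono[OF wt_ge_lie_exp_diff]) auto
    from bisupp_add[OF this H] have K: "wt_ge n (2 * n + 1) (K - leading_part n a c)"
      by simp
    \<comment> \<open>The generator changes \<open>H\<close> only from weight 3 n on, so degrees up
      to 2 still come from \<open>leading_part\<close>.\<close>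
    have low: "bicoeff K (j * n + l) l = bicoeff (leading_part n a c) (j * n + l) l" if "j + l \<le> 2" for j l
    proof -
      have "n * (j + l) < 2 * n + 1"
        by (rule le_less_trans[OF mult_le_mono2[OF that]]) simp
      with wt_geD[OF K, of "j * n + l" l] show ?thesis
        by (simp add: wt_resonant[OF n0(2)])
    qed
    have R: "R f + hom_op n a c (hom_solve n a c (R f)) = K"
      by (simp add: f(2)) (simp add: R_def K_def)
    let ?a = "2 * \<i> * of_nat n * of_real a" and ?c = "2 * \<i> * of_nat n * of_real c"
    have "even l \<and> (j = 1 \<and> 2 \<le> l \<or> j = 2 \<and> bicoeff K (j * n + l) l \<in> \<real>)"
      if j: "1 \<le> j" and nz: "bicoeff K (j * n + l) l \<noteq> 0" for j l
    proof (cases "j + l < 3")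
      case True
      then consider "j = 1" "l = 0" | "j = 1" "l = 1" | "j = 2" "l = 0"
        using j by linarith
      then show ?thesis
        using low[of j l] nz n by cases (auto simp: leading_part_def bicoeff_bimonom)
    next
      case False
      then have m: "3 \<le> j + l" by simp
      note eq = bicoeff_hom_op_hom_solve[OF n0(1) m j, of "R f" a c, unfolded R]
      have "odd (j + l) \<and> j = 1 \<or> even (j + l) \<and> j = 2"
        using chain_residual_chain_solution[of ?a ?c "j + l" j, OF _ _ m j] nz ac n unfolding eq by auto
      moreover have "bicoeff K (j * n + l) l \<in> \<real>" if "even (j + l)" "j = 2"
        using chain_residual_2[of ?c "j + l" ?a] that m ac n unfolding eq by simp
      ultimately show ?thesis
        using m by auto
    qed
    moreover have "bicoeff K l l = 0" if "l < 2" for l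
      using low[of 0 l] that n by (auto simp: leading_part_def bicoeff_bimonom)
    ultimately show ?thesis
      unfolding reduced_def by blast
  qed
  ultimately show ?thesis by blast
qed

text \<open>With \<open>w = z^n\<close>, the flow of \<open>g w\<close> shifts \<open>I\<close> by a multiple of \<open>w\<close>; this completes the
  square in \<open>a I^2 + b1 I w + b2 w^2\<close> and leaves \<open>(b2 - b1^2 / (4 a)) w^2\<close>.\<close>

lemma lie_exp_complete_square:
  assumes n: "3 \<le> n" and H: "wt_ge n (2 * n) H"
  defines "\<eta> \<equiv> \<lambda>g. bimonom g n 0 + bimonom (cnj g) 0 n"
  defines "s \<equiv> \<lambda>g. \<i> * of_nat n * g"
  shows "wt_ge n (2 * n) (lie_exp (\<eta> g) H)"
    and "bicoeff (lie_exp (\<eta> g) H) 2 2 = bicoeff H 2 2"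
    and "bicoeff (lie_exp (\<eta> g) H) (n + 1) 1 = bicoeff H (n + 1) 1 + 2 * s g * bicoeff H 2 2"
    and "bicoeff (lie_exp (\<eta> g) H) (2 * n) 0 =
      bicoeff H (2 * n) 0 + s g * bicoeff H (n + 1) 1 + (s g)\<^sup>2 * bicoeff H 2 2"
proof -
  have n0: "0 < n" using n by simp
  have wt_\<eta>: "wt_ge n n (\<eta> g)"
    unfolding \<eta>_def using n by (intro bisupp_add bisupp_bimonom) (auto simp: wt_def)
  have ord_\<eta>: "ord_ge 3 (\<eta> g)"
    unfolding \<eta>_def using n by (intro bisupp_add bisupp_bimonom) auto
  have wt_ham: "wt_ge n (2 * n) (ham_deriv (\<eta> g) f)" if "wt_ge n (2 * n) f" for f
    using wt_ge_ham_deriv[OF n0 wt_\<eta> that] by simp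
  have wt_term: "wt_ge n (2 * n) (lie_term (\<eta> g) k H)" for k
    by (rule bisupp_lie_term[where P = "\<lambda>_ a b. 2 * n \<le> wt n a b"]) (use wt_ham H in auto)
  then show "wt_ge n (2 * n) (lie_exp (\<eta> g) H)"
    by (rule bisupp_lie_exp)
  have ham: "bicoeff (ham_deriv (\<eta> g) f) p q = - \<i> *
     ((if n - 1 \<le> q then of_nat n * cnj g * (of_nat (Suc p) * bicoeff f (Suc p) (q - (n - 1))) else 0)
    - (if n - 1 \<le> p then of_nat n * g * (of_nat (Suc q) * bicoeff f (p - (n - 1)) (Suc q)) else 0))" for f p q
  proof -
    have "bimonom 0 k l = 0" for k l
      by (rule bifps_eqI) (simp add: bicoeff_bimonom)
    then show ?thesis
      by (simp add: \<eta>_def ham_deriv_def poisson_def deriv_z_add deriv_zbar_add deriv_z_bimonom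
          deriv_zbar_bimonom mult.commute[of "deriv_z f"] mult.commute[of "deriv_zbar f"]
          bicoeff_bimonom_mult del: of_nat_Suc)
  qed
  have ham22: "bicoeff (ham_deriv (\<eta> g) f) 2 2 = 0" if "wt_ge n (2 * n) f" for f
  proof -
    \<comment> \<open>The premise holds only for n = 3; the coefficients are then those of
      \<open>z^3\<close> and \<open>zbar^3\<close>, whose weight 3 is below 6.\<close>
    have "bicoeff f (Suc 2) (2 - (n - 1)) = 0" "bicoeff f (2 - (n - 1)) (Suc 2) = 0" if "n - 1 \<le> 2"
      using that n by (intro wt_geD[OF \<open>wt_ge n (2 * n) f\<close>]; simp add: wt_def)+
    then show ?thesis by (simp add: ham del: of_nat_Suc)
  qed
  have ham11: "bicoeff (ham_deriv (\<eta> g) f) (n + 1) 1 = 2 * s g * bicoeff f 2 2" for f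
  proof -
    have "bicoeff (ham_deriv (\<eta> g) f) (n + 1) 1 =
        - \<i> * (0 - of_nat n * g * (of_nat 2 * bicoeff f 2 2))"
    proof -
      have "n + 1 - (n - 1) = 2" "(n - 1 \<le> 1) = False" "(n - 1 \<le> n + 1) = True" "Suc 1 = 2" using n by auto
      then show ?thesis
        unfolding ham by (simp only: if_True if_False)
    qed
    then show ?thesis by (simp add: s_def)
  qed
  have ham20: "bicoeff (ham_deriv (\<eta> g) f) (2 * n) 0 = s g * bicoeff f (n + 1) 1" for f
  proof -
    have "bicoeff (ham_deriv (\<eta> g) f) (2 * n) 0 =
        - \<i> * (0 - of_nat n * g * (of_nat 1 * bicoeff f (n + 1) 1))"
    proof -
      have "2 * n - (n - 1) = n + 1" "(n - 1 \<le> 0) = False" "(n - 1 \<le> 2 * n) = True" "Suc 0 = 1" using n by auto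
      then show ?thesis
        unfolding ham by (simp only: if_True if_False)
    qed
    then show ?thesis by (simp add: s_def)
  qed
  let ?t = "\<lambda>k. lie_term (\<eta> g) k H"
  have t22: "bicoeff (?t (Suc k)) 2 2 = 0" for k
    by (simp add: lie_term_Suc ham22 wt_term)
  have t11: "bicoeff (?t (Suc k)) (n + 1) 1 = (if k = 0 then 2 * s g * bicoeff H 2 2 else 0)" for k
    unfolding lie_term_Suc bicoeff_biconst_mult ham11 using t22 by (cases k) (simp_all del: One_nat_def)
  \<comment> \<open>This generator does not raise the weight, but in the quadratic part each bracket
    trades a factor \<open>I\<close> for \<open>w\<close>, so the series stops after two
    brackets.\<close>
  have t20: "bicoeff (?t (Suc k)) (2 * n) 0 =
      (if k = 0 then s g * bicoeff H (n + 1) 1 else if k = 1 then (s g)\<^sup>2 * bicoeff H 2 2 else 0)" for k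
    unfolding lie_term_Suc bicoeff_biconst_mult ham20 using t11
    by (cases k) (simp_all add: power2_eq_square)
  have sum: "bicoeff (lie_exp (\<eta> g) H) p q = bicoeff H p q + bicoeff (?t (Suc 0)) p q + bicoeff (?t (Suc 1)) p q"
    if "\<And>k. bicoeff (?t (Suc (Suc (Suc k)))) p q = 0" for p q
  proof -
    have "bicoeff (lie_exp (\<eta> g) H) p q = (\<Sum>k\<le>Suc (Suc (p + q)). bicoeff (?t k) p q)"
      by (rule bicoeff_lie_exp[OF ord_\<eta>]) simp
    also have "\<dots> = bicoeff H p q + bicoeff (?t (Suc 0)) p q + (\<Sum>k\<le>p + q. bicoeff (?t (Suc (Suc k))) p q)"
      by (simp only: sum.atMost_Suc_shift lie_term_0 add.assoc)
    also have "(\<Sum>k\<le>p + q. bicoeff (?t (Suc (Suc k))) p q) = (\<Sum>k\<le>p + q. if k = 0 then bicoeff (?t (Suc 1)) p q else 0)"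
    proof (rule sum.cong[OF refl])
      show "bicoeff (?t (Suc (Suc k))) p q = (if k = 0 then bicoeff (?t (Suc 1)) p q else 0)" for k
        using that by (cases k) simp_all
    qed
    finally show ?thesis by simp
  qed
  show "bicoeff (lie_exp (\<eta> g) H) 2 2 = bicoeff H 2 2"
    by (subst sum) (simp_all only: t22 add_0_right)
  show "bicoeff (lie_exp (\<eta> g) H) (n + 1) 1 = bicoeff H (n + 1) 1 + 2 * s g * bicoeff H 2 2"
    by (subst sum) (simp_all only: t11, simp_all)
  show "bicoeff (lie_exp (\<eta> g) H) (2 * n) 0 =
      bicoeff H (2 * n) 0 + s g * bicoeff H (n + 1) 1 + (s g)\<^sup>2 * bicoeff H 2 2"
    by (subst sum) (simp_all only: t20, simp_all)
qed

lemma takens_equiv_preserves: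
  assumes "takens_equiv n H K"
  shows "resonant n 0 H \<Longrightarrow> resonant n 0 K" "real_valued H \<Longrightarrow> real_valued K"
  using assms resonant_bi_compose real_valued_bi_compose
  by (auto simp: takens_equiv_def formal_area_preserving_def)

lemma normalize_leading_part:
  assumes n: "3 \<le> n" and H: "wt_ge n (2 * n) H" "resonant n 0 H" "real_valued H"
    and a: "bicoeff H 2 2 = of_real a" "a \<noteq> 0"
    and disc: "(bicoeff H (n + 1) 1)\<^sup>2 \<noteq> 4 * of_real a * bicoeff H (2 * n) 0"
  shows "\<exists>K c. takens_equiv n H K \<and> c \<noteq> 0 \<and> wt_ge n (2 * n + 1) (K - leading_part n a c)"
proof -
  define b1 where "b1 = bicoeff H (n + 1) 1"
  \<comment> \<open>The solution of b1 + 2 s a = 0 with s = i n g, which removes the term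
    \<open>I w\<close>.\<close>
  define g where "g = \<i> * b1 / (2 * of_nat n * of_real a)"
  define \<eta> where "\<eta> = bimonom g n 0 + bimonom (cnj g) 0 n"
  have s: "\<i> * of_nat n * g = - b1 / (2 * of_real a)"
    using n a by (simp add: g_def field_simps)
  define L where "L = lie_exp \<eta> H"
  note L_coeff = lie_exp_complete_square(2-4)[OF n H(1), of g, folded \<eta>_def L_def, unfolded s a(1), folded b1_def]
  have L: "wt_ge n (2 * n) L"
    unfolding L_def \<eta>_def by (rule lie_exp_complete_square(1)[OF n H(1)])
  define h where "h = bicoeff L (2 * n) 0"
  have "h = (4 * of_real a * bicoeff H (2 * n) 0 - b1\<^sup>2) / (4 * of_real a)"
    using L_coeff(3) a by (simp add: h_def field_simps power2_eq_square)
  then have h: "h \<noteq> 0"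
    using disc a by (simp add: b1_def)
  have equiv_L: "takens_equiv n H L"
    unfolding L_def
  proof (rule takens_equiv_lie_exp)
    show "ord_ge 3 \<eta>" "resonant n 0 \<eta>"
      unfolding \<eta>_def resonant_def using n by (intro bisupp_add bisupp_bimonom; simp)+
    show "real_valued \<eta>"
      by (simp add: real_valued_def \<eta>_def conj_add conj_bimonom add.commute)
  qed
  \<comment> \<open>The rotation multiplies the coefficient of \<open>z^(2 n)\<close> by
    \<open>u ^ (2 * n)\<close>, which turns \<open>h\<close> into its modulus.\<close>
  define u where "u = cis (- Arg h / (2 * n))"
  define K where "K = bi_compose L (biconst u * varz)"
  have u: "cmod u = 1" by (simp add: u_def)
  have "takens_equiv n L K"
    unfolding K_def by (rule takens_equiv_scale[OF u])
  with equiv_L have equiv: "takens_equiv n H K"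
    by (rule takens_equiv_trans)
  have uu: "u * cnj u = 1"
    using complex_norm_square[of u] u by simp
  have u_pow: "u ^ (2 * n) * h = of_real (cmod h)"
  proof -
    have "u ^ (2 * n) = cis (- Arg h)"
      using n by (simp add: u_def Complex.DeMoivre del: of_nat_mult)
    moreover have "h = of_real (cmod h) * cis (Arg h)"
      using rcis_cmod_Arg[of h] by (simp add: rcis_def)
    ultimately show ?thesis
      by (metis cis_mult ab_left_minus cis_zero mult.commute mult.left_commute mult.right_neutral)
  qed
  have K_coeff: "bicoeff K k l = u ^ k * cnj u ^ l * bicoeff L k l" for k l
    by (simp add: K_def bicoeff_bi_compose_scale)
  have K22: "bicoeff K 2 2 = of_real a"
    using uu L_coeff(1) by (simp add: K_coeff flip: power_mult_distrib)
  have K11: "bicoeff K (n + 1) 1 = 0"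
    using L_coeff(2) a by (simp add: K_coeff)
  have K20: "bicoeff K (2 * n) 0 = of_real (cmod h)"
    using u_pow by (simp add: K_coeff h_def)
  have real_K: "bicoeff K l k = cnj (bicoeff K k l)" for k l
    using takens_equiv_preserves(2)[OF equiv H(3)] by (metis bicoeff_conj real_valued_def)
  have half: "bicoeff (K - leading_part n a (cmod h)) k l = 0"
    if wt: "wt n k l < 2 * n + 1" and dvd: "int n dvd int k - int l" and kl: "l \<le> k" for k l
  proof -
    have "n dvd k - l"
      using dvd kl by (metis int_dvd_int_iff of_nat_diff)
    then obtain j where k: "k = j * n + l"
      using kl by (metis dvd_def le_add_diff_inverse2 mult.commute)
    have n2: "2 \<le> n" using n by simp
    have "n * (j + l) < 2 * n + 1"
      using wt by (simp add: k wt_resonant[OF n2])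
    also have "\<dots> \<le> n * 3"
      using n by simp
    finally have "j + l < 3"
      by simp
    then consider "j + l < 2" | "j = 0" "l = 2" | "j = 1" "l = 1" | "j = 2" "l = 0"
      by fastforce
    then show ?thesis
    proof cases
      case 1
      then have "n * (j + l) < n * 2" using n by simp
      then have "bicoeff K k l = 0"
        unfolding K_coeff k using wt_geD[OF L, of "j * n + l" l] by (simp add: wt_resonant[OF n2])
      moreover have "bicoeff (leading_part n a (cmod h)) k l = 0"
        using 1 n k by (auto simp: leading_part_def bicoeff_bimonom)
      ultimately show ?thesis by simp
    next
      case 2
      then have "k = 2" "l = 2" using k by simp_all
      then show ?thesis
        using K22 n by (simp add: leading_part_def bicoeff_bimonom)
    qed (use K22 K11 K20 k n in \<open>auto simp: leading_part_def bicoeff_bimonom\<close>)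
  qed
  have "wt_ge n (2 * n + 1) (K - leading_part n a (cmod h))"
  proof (rule wt_geI)
    fix k l assume wt: "wt n k l < 2 * n + 1"
    show "bicoeff (K - leading_part n a (cmod h)) k l = 0"
    proof (cases "int n dvd int k - int l")
      case True
      then have dvd': "int n dvd int l - int k"
        by (metis dvd_minus_iff minus_diff_eq)
      have "bicoeff (leading_part n a (cmod h)) l k = cnj (bicoeff (leading_part n a (cmod h)) k l)"
        by (auto simp: leading_part_def bicoeff_bimonom)
      then show ?thesis
        using half[OF wt True] half[of l k, unfolded wt_commute[of n l k], OF wt dvd'] real_K[of k l]
        by (cases "l \<le> k") auto
    next
      case False
      have "int n dvd int k - int l" if "k = 2 * n \<and> l = 0 \<or> k = 0 \<and> l = 2 * n \<or> k = 2 \<and> l = 2"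
        using that by auto
      with False have "bicoeff (leading_part n a (cmod h)) k l = 0"
        by (auto simp: leading_part_def bicoeff_bimonom)
      moreover have "bicoeff K k l = 0"
        using takens_equiv_preserves(1)[OF equiv H(2)] False by (auto simp: resonant_def bisupp_def)
      ultimately show ?thesis by simp
    qed
  qed
  then show ?thesis
    using equiv h by (intro exI[of _ K] exI[of _ "cmod h"]) simp
qed

section \<open>Polar coordinates\<close>

text \<open>Multiplication by \<open>cis \<phi> ^ d\<close> turns the difference of the two sides
  into a polynomial in \<open>cis (2 * \<phi>)\<close> with infinitely many roots. Several indices
  \<open>s\<close> may share an exponent, whence the sum over a fibre of \<open>r\<close>.\<close>

lemma polar_coeff_unique:
  fixes c :: "nat \<Rightarrow> complex" and e :: "'s \<Rightarrow> complex" and r :: "'s \<Rightarrow> nat"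
  assumes S: "finite S" "\<And>s. s \<in> S \<Longrightarrow> r s \<le> d"
    and eq: "\<And>\<phi>. (\<Sum>k\<le>d. c k * (cis \<phi> ^ k * cis (- \<phi>) ^ (d - k))) =
      (\<Sum>s\<in>S. e s * (cis \<phi> ^ r s * cis (- \<phi>) ^ (d - r s)))"
    and k: "k \<le> d"
  shows "c k = (\<Sum>s\<in>{s \<in> S. r s = k}. e s)"
proof -
  define g where "g k = c k - (\<Sum>s\<in>{s \<in> S. r s = k}. e s)" for k
  have zero: "(\<Sum>k\<le>d. g k * cis (2 * \<phi>) ^ k) = 0" for \<phi>
  proof -
    let ?w = "\<lambda>k. cis \<phi> ^ k * cis (- \<phi>) ^ (d - k)"
    have w: "?w k * cis \<phi> ^ d = cis (2 * \<phi>) ^ k" if "k \<le> d" for k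
    proof -
      have "?w k * cis \<phi> ^ d = cis \<phi> ^ k * cis \<phi> ^ k * (cis (- \<phi>) * cis \<phi>) ^ (d - k)"
        using that unfolding power_mult_distrib by (simp add: algebra_simps flip: power_add)
      then show ?thesis
        by (simp add: cis_mult flip: power_mult_distrib)
    qed
    have "(\<Sum>s\<in>S. e s * ?w (r s)) = (\<Sum>k\<le>d. \<Sum>s\<in>{s \<in> S. r s = k}. e s * ?w (r s))"
      using S by (intro sum.group[symmetric]) auto
    also have "\<dots> = (\<Sum>k\<le>d. (\<Sum>s\<in>{s \<in> S. r s = k}. e s) * ?w k)"
      by (simp add: sum_distrib_right)
    finally have "(\<Sum>k\<le>d. g k * ?w k) = 0"
      using eq[of \<phi>] by (simp add: g_def left_diff_distrib sum_subtractf)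
    then have "(\<Sum>k\<le>d. g k * ?w k * cis \<phi> ^ d) = 0"
      by (simp flip: sum_distrib_right)
    then show ?thesis
      using w by (simp add: mult.assoc)
  qed
  have "inj_on cis {0..1}"
  proof (rule inj_onI)
    fix x y :: real assume "x \<in> {0..1}" "y \<in> {0..1}" "cis x = cis y"
    then show "x = y"
      using cos_inj_pi[of x y] pi_gt3 by (auto simp: complex_eq_iff)
  qed
  then have "infinite (cis ` {0..1})"
    using finite_imageD infinite_Icc[of 0 "1::real"] by fastforce
  moreover have "cis ` {0..1} \<subseteq> {x. (\<Sum>k\<le>d. g k * x ^ k) = 0}"
    using zero[of "_ / 2"] by auto
  ultimately have "infinite {x. (\<Sum>k\<le>d. g k * x ^ k) = 0}"
    using finite_subset by blast
  then have "g k = 0"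
    using k polyfun_finite_roots[of g d] by blast
  then show ?thesis
    by (simp add: g_def)
qed

lemma finite_affine_index:
  assumes "0 < n"
  shows "finite {(j, k). 1 \<le> j \<and> j * n + 2 * k = (d :: nat)}"
proof (rule finite_subset)
  show "{(j, k). 1 \<le> j \<and> j * n + 2 * k = d} \<subseteq> {..d} \<times> {..d}"
  proof clarify
    fix j k assume "d = j * n + 2 * k"
    moreover have "j * 1 \<le> j * n" using assms by (intro mult_le_mono2) simp
    ultimately show "j \<in> {..j * n + 2 * k} \<and> k \<in> {..j * n + 2 * k}"
      unfolding atMost_iff by linarith
  qed
qed simp

lemma
  assumes n: "0 < n"
    and polar: "\<And>d \<phi>. polar_coeff H d \<phi> = complex_of_real (
           (\<Sum>k | 2 * (2 + k) = d. a k) +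
           (\<Sum>(j, k) | 1 \<le> j \<and> j * n + 2 * k = d. A j k * cos (real (j * n) * \<phi> + \<beta> j k)))"
  shows polar_coeff_diagonal: "bicoeff H (2 + k) (2 + k) = of_real (a k)"
    and polar_coeff_off_diagonal: "1 \<le> j \<Longrightarrow> bicoeff H (j * n + k) k = of_real (A j k / 2) * cis (\<beta> j k)"
proof -
  let ?J = "\<lambda>d. {(j, k). 1 \<le> j \<and> j * n + 2 * k = d}" and ?K = "\<lambda>d. {k. 2 * (2 + k) = d}"
  \<comment> \<open>A disjoint sum of three families: the powers of \<open>I\<close>, and the two
    exponentials into which each cosine splits.\<close>
  define S where "S d = ?K d <+> (?J d <+> ?J d)" for d
  define e where "e = case_sum (\<lambda>k. complex_of_real (a k))
    (case_sum (\<lambda>(j, k). of_real (A j k / 2) * cis (\<beta> j k)) (\<lambda>(j, k). of_real (A j k / 2) * cis (- \<beta> j k)))"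
  define r where "r = case_sum (\<lambda>k. 2 + k) (case_sum (\<lambda>(j, k). j * n + k) (\<lambda>(j :: nat, k :: nat). k))"
  have fin: "finite (?J d)" "finite (?K d)" for d
    using finite_affine_index[OF n, of d] by (auto intro: finite_subset[of _ "{..d}"])
  have coeff: "bicoeff H k (d - k) = (\<Sum>s\<in>{s \<in> S d. r s = k}. e s)" if "k \<le> d" for k d
  proof (rule polar_coeff_unique[where d = d])
    show "finite (S d)" "\<And>s. s \<in> S d \<Longrightarrow> r s \<le> d"
      using fin by (auto simp: S_def r_def)
    fix \<phi>
    let ?w = "\<lambda>k. cis \<phi> ^ k * cis (- \<phi>) ^ (d - k)"
    have w: "cis \<phi> ^ (m + l) * cis (- \<phi>) ^ l = cis (real m * \<phi>)"
      "cis \<phi> ^ l * cis (- \<phi>) ^ (m + l) = cis (- (real m * \<phi>))" for m l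
      unfolding Complex.DeMoivre cis_mult by (simp_all add: algebra_simps)
    have "(\<Sum>s\<in>S d. e s * ?w (r s)) = (\<Sum>k\<in>?K d. of_real (a k) * ?w (2 + k)) +
      ((\<Sum>(j, k)\<in>?J d. of_real (A j k / 2) * cis (\<beta> j k) * ?w (j * n + k)) +
       (\<Sum>(j, k)\<in>?J d. of_real (A j k / 2) * cis (- \<beta> j k) * ?w k))"
      using fin by (simp add: S_def sum.Plus o_def e_def r_def case_prod_unfold)
    also have "\<dots> = (\<Sum>k\<in>?K d. of_real (a k)) +
      (\<Sum>(j, k)\<in>?J d. of_real (A j k / 2) * cis (\<beta> j k) * ?w (j * n + k) + of_real (A j k / 2) * cis (- \<beta> j k) * ?w k)"
      unfolding case_prod_unfold sum.distrib
    proof (intro arg_cong2[of _ _ _ _ "(+)"] refl sum.cong)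
      fix k assume "k \<in> ?K d"
      then have "d - (2 + k) = 2 + k" by auto
      then have "?w (2 + k) = 1"
        using w(1)[of 0 "2 + k"] by simp
      then show "of_real (a k) * ?w (2 + k) = of_real (a k)"
        by simp
    qed
    also have "(\<Sum>(j, k)\<in>?J d. of_real (A j k / 2) * cis (\<beta> j k) * ?w (j * n + k) + of_real (A j k / 2) * cis (- \<beta> j k) * ?w k) =
       (\<Sum>(j, k)\<in>?J d. of_real (A j k * cos (real (j * n) * \<phi> + \<beta> j k)))"
    proof (intro sum.cong refl prod.case_cong)
      fix x j k assume "x \<in> ?J d" "x = (j, k)"
      then have "d - (j * n + k) = k" "d - k = j * n + k" by auto
      then show "of_real (A j k / 2) * cis (\<beta> j k) * ?w (j * n + k) + of_real (A j k / 2) * cis (- \<beta> j k) * ?w k =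
          of_real (A j k * cos (real (j * n) * \<phi> + \<beta> j k))"
        by (simp only: w mult.assoc) (simp add: complex_eq_iff cos_add field_simps)
    qed
    finally show "(\<Sum>k\<le>d. bicoeff H k (d - k) * ?w k) = (\<Sum>s\<in>S d. e s * ?w (r s))"
      using polar[of d \<phi>] by (simp add: polar_coeff_def case_prod_unfold)
  qed (rule that)
  show "bicoeff H (2 + k) (2 + k) = of_real (a k)"
  proof -
    have "j * n = 0" if "j * n + i = Suc (Suc k)" "j * n + 2 * i = Suc (Suc (Suc (Suc (2 * k))))" for i j
      using that by linarith
    then have "{s \<in> S (2 * (2 + k)). r s = 2 + k} = {Inl k}"
      using n by (fastforce simp: S_def r_def)
    then show ?thesis
      using coeff[of "2 + k" "2 * (2 + k)"] by (simp add: e_def)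
  qed
  show "bicoeff H (j * n + k) k = of_real (A j k / 2) * cis (\<beta> j k)" if "1 \<le> j"
  proof -
    have "0 < j * n" using n that by simp
    then have "Suc (Suc i) \<noteq> j * n + k" if "Suc (Suc (Suc (Suc (2 * i)))) = j * n + 2 * k" for i
      using that by linarith
    moreover have "i = j" if "i * n + l = j * n + k" "i * n + 2 * l = j * n + 2 * k" for i l
    proof -
      have "i * n = j * n" using that by linarith
      then show ?thesis using n by simp
    qed
    ultimately have "{s \<in> S (j * n + 2 * k). r s = j * n + k} = {Inr (Inl (j, k))}"
      using n that by (auto simp: S_def r_def)
    then show ?thesis
      using coeff[of "j * n + k" "j * n + 2 * k"] by (simp add: e_def)
  qed
qed

lemma polar_pair:
  "x * (cis \<phi> ^ (m + l) * cis (- \<phi>) ^ l) + cnj x * (cis \<phi> ^ l * cis (- \<phi>) ^ (m + l)) =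
     of_real (2 * cmod x * cos (real m * \<phi> + Arg x))"
proof -
  have w: "cis \<phi> ^ (m + l) * cis (- \<phi>) ^ l = cis (real m * \<phi>)"
    "cis \<phi> ^ l * cis (- \<phi>) ^ (m + l) = cis (- (real m * \<phi>))"
    unfolding Complex.DeMoivre cis_mult by (simp_all add: algebra_simps)
  have "x = cmod x * cis (Arg x)"
    using rcis_cmod_Arg[of x] by (simp add: rcis_def)
  then have "x * cis (real m * \<phi>) = of_real (cmod x) * cis (real m * \<phi> + Arg x)"
    by (metis cis_mult mult.assoc mult.commute)
  moreover have "cnj x * cis (- (real m * \<phi>)) = cnj (x * cis (real m * \<phi>))"
    by (simp add: cis_cnj)
  ultimately show ?thesis
    unfolding w by (simp add: complex_eq_iff)
qed

lemma polar_coeff_reduced: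
  assumes n: "0 < n" and K: "reduced n K" "resonant n 0 K" "real_valued K"
  shows "\<exists>a b c \<psi>. \<forall>d \<phi>. polar_coeff K d \<phi> = complex_of_real (
    (\<Sum>k | 2 * (2 + k) = d. a k) +
    (\<Sum>k | 1 \<le> k \<and> n + 4 * k = d. b k * cos (real n * \<phi> + \<psi> k)) +
    (\<Sum>k | 2 * n + 4 * k = d. c k * cos (real (2 * n) * \<phi>)))"
proof (intro exI allI)
  fix d \<phi>
  let ?I0 = "{k. 2 * (2 + k) = d}" and ?I1 = "{k. 1 \<le> k \<and> n + 4 * k = d}" and ?I2 = "{k. 2 * n + 4 * k = d}"
  let ?f = "\<lambda>r. bicoeff K r (d - r) * (cis \<phi> ^ r * cis (- \<phi>) ^ (d - r))"
  \<comment> \<open>The exponents of \<open>z\<close> at which degree \<open>d\<close> can be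
    nonzero: the diagonal, then each harmonic together with its mirror image.\<close>
  let ?U = "[(+) 2 ` ?I0, (\<lambda>k. n + 2 * k) ` ?I1, (*) 2 ` ?I1, (\<lambda>k. 2 * n + 2 * k) ` ?I2, (*) 2 ` ?I2]"
  have real: "bicoeff K l k = cnj (bicoeff K k l)" for k l
    using K(3) by (metis bicoeff_conj real_valued_def)
  have fin: "finite ?I0" "finite ?I1" "finite ?I2"
    by (auto intro: finite_subset[of _ "{..d}"])
  have in_U: "r \<in> \<Union> (set ?U)" if "r \<le> d" "?f r \<noteq> 0" for r
  proof -
    define l where "l = d - r"
    have d: "d = r + l" using that by (simp add: l_def)
    have half: "r = l \<and> 2 \<le> l \<or> (\<exists>i. l = 2 * i \<and> (r = n + l \<and> 1 \<le> i \<or> r = 2 * n + l))"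
      if nz: "bicoeff K r l \<noteq> 0" and rl: "l \<le> r" for r l
    proof -
      have "int n dvd int (r - l)"
        using K(2) nz rl by (auto simp: resonant_def bisupp_def of_nat_diff)
      then obtain j where r: "r = j * n + l"
        using rl by (metis dvd_def int_dvd_int_iff le_add_diff_inverse2 mult.commute)
      show ?thesis
      proof (cases "j = 0")
        case True
        then show ?thesis
          using K(1) nz r by (auto simp: reduced_def not_less[symmetric])
      next
        case False
        then have "even l \<and> (j = 1 \<and> 2 \<le> l \<or> j = 2)"
          using K(1) nz r by (auto simp: reduced_def Suc_le_eq)
        then show ?thesis using r by (auto elim!: evenE)
      qed
    qed
    have nz: "bicoeff K r l \<noteq> 0" using that(2) by (auto simp: l_def)
    then have nz': "bicoeff K l r \<noteq> 0" using real[of r l] by simp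
    show ?thesis
    proof (cases "l \<le> r")
      case True
      from half[OF nz True] consider "r = l" "2 \<le> l"
        | i where "l = 2 * i" "r = n + l" "1 \<le> i" | i where "l = 2 * i" "r = 2 * n + l" by blast
      then show ?thesis
      proof cases
        case 1
        then have "r = 2 + (l - 2)" "l - 2 \<in> ?I0" by (simp_all add: d)
        then show ?thesis by auto
      next
        case 2
        then have "r = n + 2 * i" "i \<in> ?I1" by (simp_all add: d)
        then show ?thesis by auto
      next
        case 3
        then have "r = 2 * n + 2 * i" "i \<in> ?I2" by (simp_all add: d)
        then show ?thesis by auto
      qed
    next
      case False
      then have "r \<le> l" "r \<noteq> l" by simp_all
      with half[OF nz'] consider i where "r = 2 * i" "l = n + r" "1 \<le> i"
        | i where "r = 2 * i" "l = 2 * n + r" by blast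
      then show ?thesis
      proof cases
        case 1
        then have "i \<in> ?I1" by (simp add: d)
        with 1 show ?thesis by auto
      next
        case 2
        then have "i \<in> ?I2" by (simp add: d)
        with 2 show ?thesis by auto
      qed
    qed
  qed
  have "polar_coeff K d \<phi> = sum ?f {..d}"
    by (simp add: polar_coeff_def)
  also have "\<dots> = sum ?f ((+) 2 ` ?I0 \<union> ((\<lambda>k. n + 2 * k) ` ?I1 \<union> ((*) 2 ` ?I1 \<union> ((\<lambda>k. 2 * n + 2 * k) ` ?I2 \<union> (*) 2 ` ?I2))))"
  proof (rule sum.mono_neutral_right)
    show "\<forall>i\<in>{..d} - ((+) 2 ` ?I0 \<union> ((\<lambda>k. n + 2 * k) ` ?I1 \<union> ((*) 2 ` ?I1 \<union> ((\<lambda>k. 2 * n + 2 * k) ` ?I2 \<union> (*) 2 ` ?I2)))). ?f i = 0"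
      using in_U by fastforce
  qed auto
  also have "\<dots> = sum ?f ((+) 2 ` ?I0) + (sum ?f ((\<lambda>k. n + 2 * k) ` ?I1) + (sum ?f ((*) 2 ` ?I1) +
      (sum ?f ((\<lambda>k. 2 * n + 2 * k) ` ?I2) + sum ?f ((*) 2 ` ?I2))))"
    using fin n by (subst sum.union_disjoint; (auto; fail)?)+
  also have "\<dots> = (\<Sum>k\<in>?I0. ?f (2 + k)) + (\<Sum>k\<in>?I1. ?f (n + 2 * k) + ?f (2 * k)) +
      (\<Sum>k\<in>?I2. ?f (2 * n + 2 * k) + ?f (2 * k))"
    by (simp add: sum.reindex inj_on_def sum.distrib add.assoc)
  also have "(\<Sum>k\<in>?I0. ?f (2 + k)) = (\<Sum>k\<in>?I0. of_real (Re (bicoeff K (2 + k) (2 + k))))"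
  proof (rule sum.cong[OF refl])
    fix k assume "k \<in> ?I0"
    then have "d - (2 + k) = 2 + k" by auto
    moreover have "bicoeff K (2 + k) (2 + k) = of_real (Re (bicoeff K (2 + k) (2 + k)))"
      using real[of "2 + k" "2 + k"] by (metis Reals_cnj_iff of_real_Re)
    moreover have "cis \<phi> ^ (2 + k) * cis (- \<phi>) ^ (2 + k) = 1"
      by (simp only: cis_mult flip: power_mult_distrib) simp
    ultimately show "?f (2 + k) = of_real (Re (bicoeff K (2 + k) (2 + k)))"
      by (simp only: mult_1_right)
  qed
  also have "(\<Sum>k\<in>?I1. ?f (n + 2 * k) + ?f (2 * k)) = (\<Sum>k\<in>?I1. of_real
      (2 * cmod (bicoeff K (n + 2 * k) (2 * k)) * cos (real n * \<phi> + Arg (bicoeff K (n + 2 * k) (2 * k)))))"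
  proof (rule sum.cong[OF refl])
    fix k assume "k \<in> ?I1"
    then have *: "d - (n + 2 * k) = 2 * k" "d - 2 * k = n + 2 * k" by auto
    show "?f (n + 2 * k) + ?f (2 * k) = of_real
      (2 * cmod (bicoeff K (n + 2 * k) (2 * k)) * cos (real n * \<phi> + Arg (bicoeff K (n + 2 * k) (2 * k))))"
      unfolding * real[of "2 * k" "n + 2 * k"] by (rule polar_pair)
  qed
  also have "(\<Sum>k\<in>?I2. ?f (2 * n + 2 * k) + ?f (2 * k)) = (\<Sum>k\<in>?I2. of_real
      (2 * Re (bicoeff K (2 * n + 2 * k) (2 * k)) * cos (real (2 * n) * \<phi>)))"
  proof (rule sum.cong[OF refl])
    fix k assume "k \<in> ?I2"
    then have *: "d - (2 * n + 2 * k) = 2 * k" "d - 2 * k = 2 * n + 2 * k" by auto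
    let ?x = "bicoeff K (2 * n + 2 * k) (2 * k)"
    have "?x \<in> \<real>"
      using K(1)[unfolded reduced_def, THEN conjunct2, rule_format, of 2 "2 * k"] by (cases "?x = 0") auto
    \<comment> \<open>For real \<open>?x\<close> the argument is 0 or pi, or the modulus is 0; the
      phase reduces to a sign, which \<open>Re ?x\<close> carries.\<close>
    then have "cmod ?x * cos (real (2 * n) * \<phi> + Arg ?x) = Re ?x * cos (real (2 * n) * \<phi>)"
      using rcis_cmod_Arg[of ?x] by (auto simp: cos_add complex_eq_iff complex_is_Real_iff)
    then have "of_real (2 * Re ?x * cos (real (2 * n) * \<phi>)) = complex_of_real (2 * cmod ?x * cos (real (2 * n) * \<phi> + Arg ?x))"
      by (simp only: mult.assoc)
    then show "?f (2 * n + 2 * k) + ?f (2 * k) = of_real (2 * Re ?x * cos (real (2 * n) * \<phi>))"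
      unfolding * real[of "2 * k" "2 * n + 2 * k"] using polar_pair by simp
  qed
  finally show "polar_coeff K d \<phi> = complex_of_real (
    (\<Sum>k | 2 * (2 + k) = d. Re (bicoeff K (2 + k) (2 + k))) +
    (\<Sum>k | 1 \<le> k \<and> n + 4 * k = d. 2 * cmod (bicoeff K (n + 2 * k) (2 * k)) *
       cos (real n * \<phi> + Arg (bicoeff K (n + 2 * k) (2 * k)))) +
    (\<Sum>k | 2 * n + 4 * k = d. 2 * Re (bicoeff K (2 * n + 2 * k) (2 * k)) * cos (real (2 * n) * \<phi>)))"
    by simp
qed

lemma elliptic_resonant_order:
  assumes "elliptic_resonant F \<alpha> n"
  shows "3 \<le> n" "cis \<alpha> ^ n = 1" "\<And>m. 0 < m \<Longrightarrow> m < n \<Longrightarrow> cis \<alpha> ^ m \<noteq> 1"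
proof -
  have *: "cis \<alpha> \<notin> \<real>" "0 < n" "cis \<alpha> ^ n = 1" "\<And>m. 0 < m \<Longrightarrow> m < n \<Longrightarrow> cis \<alpha> ^ m \<noteq> 1"
    using assms by (auto simp: elliptic_resonant_def)
  have "n \<noteq> 1" using *(1,3) by auto
  moreover have "n \<noteq> 2"
  proof
    assume "n = 2"
    then have "cis \<alpha> = 1 \<or> cis \<alpha> = - 1"
      using *(3) by (simp add: power2_eq_1_iff)
    with *(1) show False by auto
  qed
  ultimately show "3 \<le> n" using *(2) by linarith
qed (use assms in \<open>auto simp: elliptic_resonant_def\<close>)

theorem theorem1:
  fixes F\<^sub>0 :: "real ^ 2 \<Rightarrow> real ^ 2" and \<alpha>\<^sub>0 :: real and n :: nat
    and N\<^sub>0 H\<^sub>0 :: bifps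
    and a :: "nat \<Rightarrow> real" and A \<beta> :: "nat \<Rightarrow> nat \<Rightarrow> real"
  assumes "area_preserving_map F\<^sub>0"
    and "elliptic_resonant F\<^sub>0 \<alpha>\<^sub>0 n"
    and "birkhoff_normal_form F\<^sub>0 \<alpha>\<^sub>0 N\<^sub>0"
    and "takens_normal_form \<alpha>\<^sub>0 H\<^sub>0"
    and "rotated_time_one_map \<alpha>\<^sub>0 H\<^sub>0 N\<^sub>0"
    and "\<And>d \<phi>. polar_coeff H\<^sub>0 d \<phi> = complex_of_real (
           (\<Sum>k | 2 * (2 + k) = d. a k) +
           (\<Sum>(j, k) | 1 \<le> j \<and> j * n + 2 * k = d. A j k * cos (real (j * n) * \<phi> + \<beta> j k)))"
    and "A 1 0 = 0"
    and "a 0 \<noteq> 0"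
    and "complex_of_real ((A 1 1)\<^sup>2) * exp (\<i> * complex_of_real (2 * \<beta> 1 1)) -
           8 * complex_of_real (a 0) * complex_of_real (A 2 0) * exp (\<i> * complex_of_real (\<beta> 2 0)) \<noteq> 0"
  shows "\<exists>C Nt Ht (a' :: nat \<Rightarrow> real) (b :: nat \<Rightarrow> real) (c :: nat \<Rightarrow> real) (\<psi> :: nat \<Rightarrow> real).
           formal_canonical_change C \<and>
           bi_compose C N\<^sub>0 = bi_compose Nt C \<and>
           real_valued Ht \<and>
           rotated_time_one_map \<alpha>\<^sub>0 Ht Nt \<and>
           (\<forall>d \<phi>. polar_coeff Ht d \<phi> = complex_of_real (
              (\<Sum>k | 2 * (2 + k) = d. a' k) +
              (\<Sum>k | 1 \<le> k \<and> n + 4 * k = d. b k * cos (real n * \<phi> + \<psi> k)) +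
              (\<Sum>k | 2 * n + 4 * k = d. c k * cos (real (2 * n) * \<phi>))))"
proof -
  note n = elliptic_resonant_order[OF assms(2)]
  have n0: "0 < n" "2 \<le> n" using n(1) by simp_all
  have H: "real_valued H\<^sub>0" "\<forall>k l. k + l < 3 \<longrightarrow> bicoeff H\<^sub>0 k l = 0"
      "bi_compose H\<^sub>0 (formal_rotation \<alpha>\<^sub>0) = H\<^sub>0"
    using assms(4) unfolding takens_normal_form_def by blast+
  have res: "resonant n 0 H\<^sub>0"
    using H(3) n0(1) n(2,3) by (rule takens_normal_form_resonant)
  note coeff = polar_coeff_off_diagonal[OF n0(1) assms(6)]
  have "bicoeff H\<^sub>0 n 0 = 0"
    using coeff[of 1 0] assms(7) by simp
  \<comment> \<open>Below weight 2 n the only resonant monomials with k >= l are 1, \<open>I\<close>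
    and \<open>w\<close>. The Takens form excludes the first two, and \<open>A 1 0 = 0\<close>
    excludes the last.\<close>
  have low: "bicoeff H\<^sub>0 k l = 0" if "l \<le> k" "wt n k l < 2 * n" for k l
  proof (rule ccontr)
    assume nz: "bicoeff H\<^sub>0 k l \<noteq> 0"
    then have "int n dvd int k - int l"
      using res unfolding resonant_def bisupp_def by force
    then have "n dvd k - l"
      using \<open>l \<le> k\<close> by (metis int_dvd_int_iff of_nat_diff)
    then obtain j where k: "k = j * n + l"
      using \<open>l \<le> k\<close> by (metis dvd_def le_add_diff_inverse2 mult.commute)
    have "n * (j + l) < n * 2"
      using that(2) unfolding k wt_resonant[OF n0(2)] by linarith
    then have "j + l < 2" by simp
    then consider "j = 0" "l \<le> 1" | "j = 1" "l = 0" by linarith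
    then show False
    proof cases
      case 1
      then have "k + l < 3" using k by simp
      then show False using nz H(2) by blast
    next
      case 2
      then show False using nz k \<open>bicoeff H\<^sub>0 n 0 = 0\<close> by simp
    qed
  qed
  have wt_H: "wt_ge n (2 * n) H\<^sub>0"
  proof (rule wt_geI)
    fix k l assume "wt n k l < 2 * n"
    moreover have "bicoeff H\<^sub>0 k l = cnj (bicoeff H\<^sub>0 l k)"
      using H(1) by (metis bicoeff_conj real_valued_def)
    ultimately show "bicoeff H\<^sub>0 k l = 0"
      using low[of l k] low[of k l] by (cases "l \<le> k") (auto simp: wt_commute[of n l k])
  qed
  have H22: "bicoeff H\<^sub>0 2 2 = of_real (a 0)"
    using polar_coeff_diagonal[OF n0(1) assms(6), of 0] by simp
  have "(bicoeff H\<^sub>0 (n + 1) 1)\<^sup>2 \<noteq> 4 * of_real (a 0) * bicoeff H\<^sub>0 (2 * n) 0"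
  proof -
    have "exp (\<i> * complex_of_real (2 * \<beta> 1 1)) = (cis (\<beta> 1 1))\<^sup>2" "exp (\<i> * complex_of_real (\<beta> 2 0)) = cis (\<beta> 2 0)"
      by (simp_all add: cis_conv_exp flip: exp_double) (simp add: mult_ac)
    then have "of_real ((A 1 1)\<^sup>2) * (cis (\<beta> 1 1))\<^sup>2 \<noteq> 8 * of_real (a 0) * of_real (A 2 0) * cis (\<beta> 2 0)"
      using assms(9) by (simp only: right_minus_eq not_False_eq_True)
    moreover have "bicoeff H\<^sub>0 (n + 1) 1 = of_real (A 1 1 / 2) * cis (\<beta> 1 1)"
      "bicoeff H\<^sub>0 (2 * n) 0 = of_real (A 2 0 / 2) * cis (\<beta> 2 0)"
      using coeff[of 1 1] coeff[of 2 0] by simp_all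
    ultimately show ?thesis
      by (simp only: power_mult_distrib) (simp add: power_divide algebra_simps)
  qed
  from normalize_leading_part[OF n(1) wt_H res H(1) H22 assms(8) this] obtain K c where
    K: "takens_equiv n H\<^sub>0 K" "c \<noteq> 0" "wt_ge n (2 * n + 1) (K - leading_part n (a 0) c)" by blast
  from normalize_higher_order[OF n(1) assms(8) K(2,3)] obtain Ht where
    Ht: "takens_equiv n K Ht" "reduced n Ht" by blast
  have equiv: "takens_equiv n H\<^sub>0 Ht"
    using K(1) Ht(1) by (rule takens_equiv_trans)
  have "real_valued Ht" "resonant n 0 Ht"
    using takens_equiv_preserves[OF equiv] H(1) res by blast+
  with polar_coeff_reduced[OF n0(1) Ht(2)] rotated_time_one_map_takens_equiv[OF equiv n(2) H(1) assms(5)]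
  show ?thesis by blast
qed

end
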